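(* The map $\mathscr{R}:\mathcal{E}(r_1,\dots,r_m)\to\mathcal{E}(r_1,\dots,r_m)$ is one-to-one; that is, for all $\widetilde{P},\widetilde{P}'\in\mathcal{E}(r_1,\dots,r_m)$, if $\mathscr{R}(\widetilde{P})=\mathscr{R}(\widetilde{P}')$ then $\widetilde{P}=\widetilde{P}'$.
   Context: Setting: $\mathcal{H}$ is a complex Hilbert space of finite dimension $n$; $r_1\ge r_2\ge\dots\ge r_m\ge 1$ are integers with $\sum_{i=1}^m r_i=n$. $\mathcal{E}(r_1,\dots,r_m)$ is the set of (ordered) ensembles $\{p_i,\rho_i\}_{i=1}^m$ with $p_i>0$, $\sum_i p_i=1$, $\rho_i$ density operators on $\mathcal{H}$ with $\mathrm{rank}(\rho_i)=r_i$, and supports $\mathrm{supp}(\rho_1),\dots,\mathrm{supp}(\rho_m)$ linearly independent and together spanning $\mathcal{H}$. An $m$-element POVM is a family $\{\Pi_i\}_{i=1}^m$ with $\Pi_i\ge 0$, $\sum_i\Pi_i=\mathbb{1}$; it is optimal for minimum error discrimination (MED) of $\{p_i,\rho_i\}$ if it maximizes $\sum_i p_i\mathrm{Tr}(\rho_i\Pi_i)$ over all $m$-element POVMs. Known fact: for an ensemble in $\mathcal{E}(r_1,\dots,r_m)$ the optimal POVM is unique and is a projective measurement with $\mathrm{rank}(\Pi_i)=r_i$. Definition of $\mathscr{R}$: given $\widetilde{P}=\{p_i,\rho_i\}\in\mathcal{E}(r_1,\dots,r_m)$ with optimal POVM $\{\Pi_i\}$, choose a decomposition $p_i\rho_i=\sum_{j=1}^{r_i}|\widetilde{\psi}_{ij}\rangle\langle\widetilde{\psi}_{ij}|$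 into unnormalized pure states for each $i$, and an orthonormal basis $\{|w_{ij}\rangle\}_{j=1}^{r_i}$ of $\mathrm{supp}(\Pi_i)$ such that the $r_i\times r_i$ matrix $(X^{(ii)})_{jk}=\langle\widetilde{\psi}_{ij}|w_{ik}\rangle$ is positive semidefinite (it is then positive definite). Put $|\widetilde{\chi}_{ij}\rangle=\sum_{k=1}^{r_i}(X^{(ii)})_{kj}|\widetilde{\psi}_{ik}\rangle$ and $$\sigma_i=\frac{\sum_{j=1}^{r_i}|\widetilde{\chi}_{ij}\rangle\langle\widetilde{\chi}_{ij}|}{\sum_{k=1}^{r_i}\langle\widetilde{\chi}_{ik}|\widetilde{\chi}_{ik}\rangle},\qquad q_i=\frac{\sum_{j=1}^{r_i}\langle\widetilde{\chi}_{ij}|\widetilde{\chi}_{ij}\rangle}{\sum_{l=1}^m\sum_{k=1}^{r_l}\langle\widetilde{\chi}_{lk}|\widetilde{\chi}_{lk}\rangle}.$$ Then $\mathscr{R}(\widetilde{P})=\{q_i,\sigma_i\}_{i=1}^m$. The result does not depend on the choices and lies in $\mathcal{E}(r_1,\dots,r_m)$, with $\mathrm{supp}(\sigma_i)=\mathrm{supp}(\rho_i)$. *)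

theory Defs
  imports "HOL-Analysis.Analysis"
begin

text \<open>The n-dimensional complex Hilbert space is \<^typ>\<open>complex^'n\<close> with n = CARD('n), and operators
  on it are square matrices. Families are indexed by {1..m}; values of auxiliary families outside
  their index range are irrelevant.\<close>

definition cinner :: "complex^'n \<Rightarrow> complex^'n \<Rightarrow> complex" where
  "cinner x y = (\<Sum>k\<in>UNIV. cnj (x $ k) * y $ k)"

definition ketbra :: "complex^'n \<Rightarrow> complex^'n \<Rightarrow> complex^'n^'n" where
  "ketbra x y = (\<chi> k l. x $ k * cnj (y $ l))"

text \<open>Over the complex numbers, a quadratic form with nonnegative real values forces the matrix to
  be Hermitian, so this need not be required separately in the next two definitions.\<close>

definition psd :: "complex^'n^'n \<Rightarrow> bool" where
  "psd A \<longleftrightarrow> (\<forall>x. cinner x (A *v x) \<in> \<real>\<^sub>\<ge>\<^sub>0)"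

text \<open>Here the size d of the matrix is a value, not a type, and the indices run over {1..d}.\<close>

definition psd_upto :: "nat \<Rightarrow> (nat \<Rightarrow> nat \<Rightarrow> complex) \<Rightarrow> bool" where
  "psd_upto d X \<longleftrightarrow> (\<forall>x. (\<Sum>j=1..d. \<Sum>k=1..d. cnj (x j) * X j k * x k) \<in> \<real>\<^sub>\<ge>\<^sub>0)"

definition supp :: "complex^'n^'n \<Rightarrow> (complex^'n) set" where
  "supp A = {x. \<forall>y. A *v y = 0 \<longrightarrow> cinner y x = 0}"

definition density_operator :: "complex^'n^'n \<Rightarrow> bool" where
  "density_operator \<rho> \<longleftrightarrow> psd \<rho> \<and> trace \<rho> = 1"

definition independent_subspaces :: "nat set \<Rightarrow> (nat \<Rightarrow> (complex^'n) set) \<Rightarrow> bool" where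
  "independent_subspaces I S \<longleftrightarrow>
     (\<forall>v. (\<forall>i\<in>I. v i \<in> S i) \<and> (\<Sum>i\<in>I. v i) = 0 \<longrightarrow> (\<forall>i\<in>I. v i = 0))"

definition orthonormal_basis_of :: "nat \<Rightarrow> (nat \<Rightarrow> complex^'n) \<Rightarrow> (complex^'n) set \<Rightarrow> bool" where
  "orthonormal_basis_of d w S \<longleftrightarrow>
     (\<forall>j\<in>{1..d}. \<forall>k\<in>{1..d}. cinner (w j) (w k) = (if j = k then 1 else 0)) \<and>
     vec.span (w ` {1..d}) = S"

text \<open>An ensemble maps i to the pair of the probability and the state with index i. It is
  extensional, so that equality of functions is equality of the m-tuples of pairs.\<close>

type_synonym 'n ensemble = "nat \<Rightarrow> real \<times> (complex^'n^'n)"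

definition ensembles :: "nat \<Rightarrow> (nat \<Rightarrow> nat) \<Rightarrow> 'n::finite ensemble set" where
  "ensembles m r = {P \<in> extensional {1..m}.
     (\<forall>i\<in>{1..m}. fst (P i) > 0 \<and> density_operator (snd (P i)) \<and> rank (snd (P i)) = r i) \<and>
     (\<Sum>i=1..m. fst (P i)) = 1 \<and>
     independent_subspaces {1..m} (\<lambda>i. supp (snd (P i))) \<and>
     vec.span (\<Union>i\<in>{1..m}. supp (snd (P i))) = UNIV}"

definition povm :: "nat \<Rightarrow> (nat \<Rightarrow> complex^'n^'n) \<Rightarrow> bool" where
  "povm m M \<longleftrightarrow> (\<forall>i\<in>{1..m}. psd (M i)) \<and> (\<Sum>i=1..m. M i) = mat 1"

text \<open>The trace is real here because both factors are positive semidefinite.\<close>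

definition success_prob :: "nat \<Rightarrow> 'n::finite ensemble \<Rightarrow> (nat \<Rightarrow> complex^'n^'n) \<Rightarrow> real" where
  "success_prob m P M = (\<Sum>i=1..m. fst (P i) * Re (trace (snd (P i) ** M i)))"

definition optimal_povm :: "nat \<Rightarrow> 'n::finite ensemble \<Rightarrow> (nat \<Rightarrow> complex^'n^'n) \<Rightarrow> bool" where
  "optimal_povm m P M \<longleftrightarrow>
     povm m M \<and> (\<forall>M'. povm m M' \<longrightarrow> success_prob m P M' \<le> success_prob m P M)"

definition gram_block ::
  "(nat \<Rightarrow> nat \<Rightarrow> complex^'n) \<Rightarrow> (nat \<Rightarrow> nat \<Rightarrow> complex^'n) \<Rightarrow> nat \<Rightarrow> nat \<Rightarrow> nat \<Rightarrow> complex" where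
  "gram_block \<psi> w i j k = cinner (\<psi> i j) (w i k)"

definition chi_vec :: "(nat \<Rightarrow> nat) \<Rightarrow> (nat \<Rightarrow> nat \<Rightarrow> complex^'n) \<Rightarrow>
    (nat \<Rightarrow> nat \<Rightarrow> complex^'n) \<Rightarrow> nat \<Rightarrow> nat \<Rightarrow> complex^'n" where
  "chi_vec r \<psi> w i j = (\<Sum>k=1..r i. gram_block \<psi> w i k j *s \<psi> i k)"

definition ensemble_of_vectors ::
    "nat \<Rightarrow> (nat \<Rightarrow> nat) \<Rightarrow> (nat \<Rightarrow> nat \<Rightarrow> complex^'n) \<Rightarrow> 'n::finite ensemble" where
  "ensemble_of_vectors m r \<chi>v = (\<lambda>i\<in>{1..m}.
     ((\<Sum>j=1..r i. Re (cinner (\<chi>v i j) (\<chi>v i j))) /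
        (\<Sum>l=1..m. \<Sum>k=1..r l. Re (cinner (\<chi>v l k) (\<chi>v l k))),
      (1 / (\<Sum>k=1..r i. Re (cinner (\<chi>v i k) (\<chi>v i k)))) *\<^sub>R
        (\<Sum>j=1..r i. ketbra (\<chi>v i j) (\<chi>v i j))))"

text \<open>All legitimate choices in the construction: an optimal POVM, a decomposition of each
  weighted state, and an orthonormal basis of the support of each POVM element that makes the
  diagonal block positive semidefinite.\<close>

definition R_choice :: "nat \<Rightarrow> (nat \<Rightarrow> nat) \<Rightarrow> 'n::finite ensemble \<Rightarrow> (nat \<Rightarrow> complex^'n^'n) \<Rightarrow>
    (nat \<Rightarrow> nat \<Rightarrow> complex^'n) \<Rightarrow> (nat \<Rightarrow> nat \<Rightarrow> complex^'n) \<Rightarrow> bool" where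
  "R_choice m r P M \<psi> w \<longleftrightarrow>
     optimal_povm m P M \<and>
     (\<forall>i\<in>{1..m}.
        fst (P i) *\<^sub>R snd (P i) = (\<Sum>j=1..r i. ketbra (\<psi> i j) (\<psi> i j)) \<and>
        orthonormal_basis_of (r i) (w i) (supp (M i)) \<and>
        psd_upto (r i) (gram_block \<psi> w i))"

text \<open>The unique ensemble produced by any legitimate choice. Existence of a choice and independence
  of it are not built in: if either failed, THE would return an unspecified value.\<close>

definition R_map :: "nat \<Rightarrow> (nat \<Rightarrow> nat) \<Rightarrow> 'n::finite ensemble \<Rightarrow> 'n ensemble" where
  "R_map m r P = (THE Q. \<exists>M \<psi> w. R_choice m r P M \<psi> w \<and>
     Q = ensemble_of_vectors m r (chi_vec r \<psi> w))"

end

theory Submission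
  imports Defs
begin

text \<open>Write A_i = p_i rho_i. The optimality conditions provide a Hermitian K with K >= A_i and
  K M_i = A_i M_i for the optimal measurement M; independence of the supports makes K invertible and
  the M_i orthogonal projections, and determines M. Since chi_ij = A_i w_ij, the map sends the A_i, up
  to a common factor, to A_i M_i A_i = K M_i K. These matrices sum to K^2, so they determine first K,
  as a positive square root, then M_i, and finally A_i, because A_i M_i = K M_i has the same range
  as A_i.\<close>

section \<open>The sesquilinear form\<close>

text \<open>\<open>R_map\<close> is a definite description, so before injectivity it must be shown
  to denote something: an optimal measurement exists by compactness, bases with positive
  semidefinite Gram blocks come from diagonalising a compression, and all choices give the same
  value. The last point requires one K that serves every optimal measurement. Independence of the
  supports acts through a single device: for any y the vectors K M_i y = A_i M_i y lie in supp A_i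
  and add up to K y, so if K y lies in one support, only one of them survives. Taking y in the range
  of M_j gives orthogonality and uniqueness; taking K y in the range of A_i shows that A_i M_i
  reaches that whole range. Normalising the image loses a positive factor. It is carried along as
  c^2, because K enters quadratically; then c scales every A_i, and total probability 1 forces c =
  1.\<close>

lemma cinner_add_left: "cinner (x + y) z = cinner x z + cinner y z"
  by (simp add: cinner_def algebra_simps sum.distrib)

lemma cinner_add_right: "cinner x (y + z) = cinner x y + cinner x z"
  by (simp add: cinner_def algebra_simps sum.distrib)

lemma cinner_diff_left: "cinner (x - y) z = cinner x z - cinner y z"
  by (simp add: cinner_def algebra_simps sum_subtractf)

lemma cinner_diff_right: "cinner x (y - z) = cinner x y - cinner x z"
  by (simp add: cinner_def algebra_simps sum_subtractf)

lemma cinner_scale_left: "cinner (c *s x) y = cnj c * cinner x y"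
  by (simp add: cinner_def sum_distrib_left algebra_simps)

lemma cinner_scale_right: "cinner x (c *s y) = c * cinner x y"
  by (simp add: cinner_def sum_distrib_left algebra_simps)

lemma cinner_scaleR_left: "cinner (c *\<^sub>R x) y = of_real c * cinner x y"
  by (simp add: cinner_def sum_distrib_left algebra_simps scaleR_conv_of_real[where 'a=complex])

lemma cinner_scaleR_right: "cinner x (c *\<^sub>R y) = of_real c * cinner x y"
  by (simp add: cinner_def sum_distrib_left algebra_simps scaleR_conv_of_real[where 'a=complex])

lemma cinner_zero_left [simp]: "cinner 0 x = 0"
  by (simp add: cinner_def)

lemma cinner_zero_right [simp]: "cinner x 0 = 0"
  by (simp add: cinner_def)

lemma cinner_sum_left: "cinner (\<Sum>i\<in>I. f i) y = (\<Sum>i\<in>I. cinner (f i) y)"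
  by (induction I rule: infinite_finite_induct) (auto simp: cinner_add_left)

lemma cinner_sum_right: "cinner x (\<Sum>i\<in>I. f i) = (\<Sum>i\<in>I. cinner x (f i))"
  by (induction I rule: infinite_finite_induct) (auto simp: cinner_add_right)

lemma cnj_cinner: "cnj (cinner x y) = cinner y x"
  by (simp add: cinner_def mult.commute)

lemma Re_cinner_commute: "Re (cinner x y) = Re (cinner y x)"
  by (metis cnj_cinner cnj.simps(1))

lemma cinner_self: "cinner x x = of_real ((norm x)\<^sup>2)"
proof -
  have "(norm x)\<^sup>2 = (\<Sum>k\<in>UNIV. (cmod (x $ k))\<^sup>2)"
    by (simp add: norm_vec_def L2_set_def sum_nonneg)
  then show ?thesis
    by (simp add: cinner_def mult.commute complex_norm_square[symmetric])
qed

lemma cinner_self_eq_0 [simp]: "cinner x x = 0 \<longleftrightarrow> x = 0"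
  by (simp add: cinner_self)

lemma Re_cinner_self_nonneg [simp]: "0 \<le> Re (cinner x x)"
  by (simp add: cinner_self)

lemma cinner_axis_left: "cinner (axis k 1) x = x $ k"
proof -
  have "cinner (axis k 1) x = (\<Sum>l\<in>UNIV. if l = k then x $ l else 0)"
    unfolding cinner_def by (intro sum.cong) (auto simp: axis_def)
  then show ?thesis by simp
qed

lemma cinner_eqI: "(\<And>z. cinner z x = cinner z y) \<Longrightarrow> x = y"
  by (metis cinner_axis_left vec_eq_iff)

section \<open>Continuity, linearity of the matrix action, traces and rank-one matrices\<close>

lemma continuous_on_cinner [continuous_intros]:
  "continuous_on S f \<Longrightarrow> continuous_on S g \<Longrightarrow> continuous_on S (\<lambda>x. cinner (f x) (g x))"
  unfolding cinner_def by (intro continuous_intros)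

lemma continuous_on_matrix_vector_mult [continuous_intros]:
  fixes f :: "'a::topological_space \<Rightarrow> complex^'n^'m"
  assumes "continuous_on S f" "continuous_on S g"
  shows "continuous_on S (\<lambda>x. f x *v g x)"
  unfolding matrix_vector_mult_def using assms by (intro continuous_intros)

lemma matrix_vector_mult_scaleR_left: "(c *\<^sub>R A) *v x = c *\<^sub>R (A *v x)"
  for A :: "complex^'n^'m"
  by (simp add: matrix_vector_mult_def vec_eq_iff scaleR_sum_right)

lemma matrix_vector_mult_scaleR_right: "A *v (c *\<^sub>R x) = c *\<^sub>R (A *v x)"
  for A :: "complex^'n^'m"
  by (simp add: matrix_vector_mult_def vec_eq_iff scaleR_sum_right)

lemma matrix_vector_mult_scale: "A *v (c *s x) = c *s (A *v x)"
  for A :: "complex^'n^'m"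
  by (simp add: matrix_vector_mult_def vec_eq_iff sum_distrib_left algebra_simps)

lemma matrix_vector_mult_sum_left: "(\<Sum>i\<in>I. A i) *v x = (\<Sum>i\<in>I. A i *v x)"
  for A :: "'i \<Rightarrow> complex^'n^'m"
  by (induction I rule: infinite_finite_induct) (auto simp: matrix_vector_mult_add_rdistrib)

lemma matrix_vector_mult_sum_right: "A *v (\<Sum>i\<in>I. f i) = (\<Sum>i\<in>I. A *v f i)"
  for A :: "complex^'n^'m"
  by (induction I rule: infinite_finite_induct) (auto simp: matrix_vector_right_distrib)

lemma matrix_mult_sum_right: "A ** (\<Sum>i\<in>I. B i) = (\<Sum>i\<in>I. A ** B i)"
  for A :: "complex^'n^'m"
  by (simp add: matrix_eq matrix_vector_mul_assoc[symmetric] matrix_vector_mult_sum_left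
      matrix_vector_mult_sum_right)

lemma matrix_mult_sum_left: "(\<Sum>i\<in>I. B i) ** A = (\<Sum>i\<in>I. B i ** A)"
  for A :: "complex^'n^'m"
  by (simp add: matrix_eq matrix_vector_mul_assoc[symmetric] matrix_vector_mult_sum_left
      matrix_vector_mult_sum_right)

lemma trace_sum: "trace (\<Sum>i\<in>I. A i) = (\<Sum>i\<in>I. trace (A i))"
  for A :: "'i \<Rightarrow> complex^'n^'n"
  by (induction I rule: infinite_finite_induct) (auto simp: trace_add, auto simp: trace_def)

lemma trace_scaleR: "trace (c *\<^sub>R A) = of_real c * trace A"
  for A :: "complex^'n^'n"
  by (simp add: trace_def sum_distrib_left scaleR_conv_of_real[where 'a=complex])

lemma cinner_axis_mult_axis: "cinner (axis i 1) (A *v axis j 1) = A $ i $ j"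
proof -
  have "(A *v axis j 1) $ i = A $ i $ j"
    by (simp add: matrix_vector_mult_def axis_def if_distrib[of "(*) _"] cong: if_cong)
  then show ?thesis by (simp add: cinner_axis_left)
qed

lemma trace_eq_sum_cinner: "trace A = (\<Sum>k\<in>UNIV. cinner (axis k 1) (A *v axis k 1))"
  by (simp add: trace_def cinner_axis_mult_axis)

lemma ketbra_mult_vec: "ketbra x y *v z = cinner y z *s x"
  by (simp add: ketbra_def matrix_vector_mult_def cinner_def vec_eq_iff sum_distrib_left
      algebra_simps)

lemma mult_ketbra: "A ** ketbra x y = ketbra (A *v x) y"
  by (simp add: matrix_eq matrix_vector_mul_assoc[symmetric] ketbra_mult_vec
      matrix_vector_mult_scale)

lemma trace_ketbra: "trace (ketbra x y) = cinner y x"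
  by (simp add: trace_def ketbra_def cinner_def mult.commute)

lemma scaleR_conv_scale: "c *\<^sub>R x = of_real c *s x" for x :: "complex^'n"
  by (simp add: vec_eq_iff scaleR_conv_of_real[where 'a=complex])

text \<open>Gives complex subspaces access to facts about real ones, above all closedness.\<close>

lemma vec_subspace_imp_subspace: "vec.subspace S \<Longrightarrow> subspace S" for S :: "(complex^'n) set"
  by (auto simp: vec.subspace_def subspace_def scaleR_conv_scale)

section \<open>Hermitian and positive semidefinite matrices\<close>

definition hermitian :: "complex^'n^'n \<Rightarrow> bool" where
  "hermitian A \<longleftrightarrow> (\<forall>x y. cinner x (A *v y) = cinner (A *v x) y)"

lemma hermitianD: "hermitian A \<Longrightarrow> cinner (A *v x) y = cinner x (A *v y)"
  by (simp add: hermitian_def)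

lemma hermitian_cinner_real: "hermitian A \<Longrightarrow> cinner x (A *v x) = of_real (Re (cinner x (A *v x)))"
  by (metis Reals_cnj_iff cnj_cinner hermitian_def of_real_Re)

lemma psd_nonneg: "psd A \<Longrightarrow> 0 \<le> Re (cinner x (A *v x))"
  by (auto simp: psd_def complex_nonneg_Reals_iff)

text \<open>Polarization: reality of the form at x + y compares the imaginary parts of the two mixed
  terms, and reality at x + i y compares their real parts.\<close>

lemma psd_hermitian:
  assumes "psd A"
  shows "hermitian A"
proof -
  have real: "Im (cinner x (A *v x)) = 0" for x
    using assms by (auto simp: psd_def complex_nonneg_Reals_iff)
  have "cinner x (A *v y) = cinner (A *v x) y" for x y
  proof (rule complex_eqI)
    have "Im (cinner x (A *v y)) = - Im (cinner y (A *v x))"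
      using real[of "x + y"] real[of x] real[of y]
      by (simp add: matrix_vector_right_distrib cinner_add_left cinner_add_right)
    then show "Im (cinner x (A *v y)) = Im (cinner (A *v x) y)"
      by (metis cnj_cinner cnj.simps(2))
    have "Re (cinner x (A *v y)) = Re (cinner y (A *v x))"
      using real[of "x + \<i> *s y"] real[of x] real[of y]
      by (simp add: matrix_vector_right_distrib matrix_vector_mult_scale cinner_add_left
          cinner_add_right cinner_scale_left cinner_scale_right)
    then show "Re (cinner x (A *v y)) = Re (cinner (A *v x) y)"
      by (metis Re_cinner_commute)
  qed
  then show ?thesis by (simp add: hermitian_def)
qed

lemma psd_iff_hermitian: "psd A \<longleftrightarrow> hermitian A \<and> (\<forall>x. 0 \<le> Re (cinner x (A *v x)))"
  by (metis psd_def psd_hermitian psd_nonneg hermitian_cinner_real nonneg_Reals_of_real_iff)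

lemma hermitian_diff: "hermitian A \<Longrightarrow> hermitian B \<Longrightarrow> hermitian (A - B)"
  by (simp add: hermitian_def cinner_diff_left cinner_diff_right matrix_vector_mult_diff_rdistrib)

lemma psd_ketbra_sum: "psd (\<Sum>j\<in>J. ketbra (v j) (v j))"
proof -
  have "cinner x (ketbra (v j) (v j) *v x) = of_real ((cmod (cinner (v j) x))\<^sup>2)" for x j
    using complex_norm_square[of "cinner (v j) x"]
    by (simp add: ketbra_mult_vec cinner_scale_right cnj_cinner)
  then have "cinner x ((\<Sum>j\<in>J. ketbra (v j) (v j)) *v x)
      = of_real (\<Sum>j\<in>J. (cmod (cinner (v j) x))\<^sup>2)" for x
    by (simp add: matrix_vector_mult_sum_left cinner_sum_right)
  then show ?thesis
    by (simp add: psd_def sum_nonneg del: of_real_sum)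
qed

text \<open>At x - t b y, where b = cinner y (A x), the form is a quadratic polynomial in t without constant
  term and with slope -2|b|^2 at 0.\<close>

lemma form_null_vector:
  assumes "hermitian A" and S: "vec.subspace S" and nonneg: "\<And>z. z \<in> S \<Longrightarrow> 0 \<le> Re (cinner z (A *v z))"
    and "x \<in> S" "y \<in> S" and null: "Re (cinner x (A *v x)) = 0"
  shows "cinner y (A *v x) = 0"
proof -
  define b where "b = cinner y (A *v x)"
  define c where "c = Re (cinner y (A *v y))"
  have c: "0 \<le> c" using nonneg[OF \<open>y \<in> S\<close>] by (simp add: c_def)
  have xy: "cinner x (A *v y) = cnj b"
    by (metis assms(1) b_def cnj_cinner hermitian_def)
  have q: "0 \<le> - 2 * t * (cmod b)\<^sup>2 + t\<^sup>2 * (cmod b)\<^sup>2 * c" for t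
  proof -
    have "x - (of_real t * b) *s y \<in> S"
      using S \<open>x \<in> S\<close> \<open>y \<in> S\<close> by (simp add: vec.subspace_diff vec.subspace_scale)
    from nonneg[OF this]
    have "0 \<le> Re (cinner x (A *v x) - of_real t * (b * cnj b) - of_real t * (b * cnj b)
        + (of_real t)\<^sup>2 * (b * cnj b) * cinner y (A *v y))"
      by (simp add: matrix_vector_mult_diff_distrib matrix_vector_mult_scale cinner_diff_left
          cinner_diff_right cinner_scale_left cinner_scale_right xy b_def[symmetric]
          algebra_simps power2_eq_square)
    then show ?thesis
      by (simp add: complex_norm_square[symmetric] null c_def del: of_real_power flip: of_real_power)
  qed
  have "- 2 * t * (cmod b)\<^sup>2 + t\<^sup>2 * (cmod b)\<^sup>2 * c = (cmod b)\<^sup>2 * t * (c * t - 2)" for t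
    by (simp add: algebra_simps power2_eq_square)
  \<comment> \<open>The value t = 1/(c + 1) is positive and keeps c t below 2 even for c = 0, so the
    last factor is negative and b must vanish.\<close>
  then have "(cmod b)\<^sup>2 * (1 / (c + 1)) * (c * (1 / (c + 1)) - 2) \<ge> 0"
    using q[of "1 / (c + 1)"] by metis
  moreover have "c * (1 / (c + 1)) - 2 < 0"
    using c by (simp add: field_simps)
  ultimately have "(cmod b)\<^sup>2 * (1 / (c + 1)) \<le> 0"
    by (metis mult_pos_neg not_le)
  with c have "(cmod b)\<^sup>2 \<le> 0"
    by (simp add: field_simps)
  then show ?thesis by (simp add: b_def)
qed

lemma psd_null_vector:
  assumes "psd A" "Re (cinner x (A *v x)) = 0"
  shows "A *v x = 0"
  by (rule cinner_eqI) (use form_null_vector[of A UNIV x] assms psd_hermitian psd_nonneg in auto)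

section \<open>Spectral theorem on an invariant subspace\<close>

lemma subspace_unit_sphere_max:
  fixes A :: "complex^'n^'n"
  assumes S: "vec.subspace S" and "S \<noteq> {0}"
  obtains x where "x \<in> S" "norm x = 1"
    "\<And>y. y \<in> S \<Longrightarrow> norm y = 1 \<Longrightarrow> Re (cinner y (A *v y)) \<le> Re (cinner x (A *v x))"
proof -
  let ?U = "S \<inter> sphere 0 1"
  obtain z where z: "z \<in> S" "z \<noteq> 0"
    using S \<open>S \<noteq> {0}\<close> vec.subspace_0 by blast
  have "(1 / norm z) *\<^sub>R z \<in> ?U"
    using z vec_subspace_imp_subspace[OF S] by (simp add: subspace_scale)
  moreover have "compact ?U"
    by (intro closed_Int_compact closed_subspace vec_subspace_imp_subspace[OF S] compact_sphere)
  moreover have "continuous_on ?U (\<lambda>x. Re (cinner x (A *v x)))"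
    by (intro continuous_intros)
  ultimately obtain x where "x \<in> ?U" "\<forall>y\<in>?U. Re (cinner y (A *v y)) \<le> Re (cinner x (A *v x))"
    using continuous_attains_sup[of ?U "\<lambda>x. Re (cinner x (A *v x))"] by blast
  then show ?thesis by (intro that[of x]) auto
qed

text \<open>Let l be the maximum of the form on the unit sphere of S, attained at x. Then B = l - A
  has a nonnegative form on S that vanishes at x, so B x is orthogonal to S by
  \<open>form_null_vector\<close>. Invariance puts B x itself in S, hence B x = 0.\<close>

lemma hermitian_eigenvector:
  fixes A :: "complex^'n^'n"
  assumes A: "hermitian A" and S: "vec.subspace S" and "S \<noteq> {0}"
    and inv: "\<And>x. x \<in> S \<Longrightarrow> A *v x \<in> S"
  obtains x l where "x \<in> S" "norm x = 1" "A *v x = of_real l *s x"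
proof -
  obtain x where x: "x \<in> S" "norm x = 1"
    and max: "\<And>y. y \<in> S \<Longrightarrow> norm y = 1 \<Longrightarrow> Re (cinner y (A *v y)) \<le> Re (cinner x (A *v x))"
    using subspace_unit_sphere_max[OF S \<open>S \<noteq> {0}\<close>, of A] by blast
  define l where "l = Re (cinner x (A *v x))"
  define B where "B = l *\<^sub>R mat 1 - A"
  have Bv: "B *v y = l *\<^sub>R y - A *v y" for y
    by (simp add: B_def matrix_vector_mult_diff_rdistrib matrix_vector_mult_scaleR_left)
  have herm: "hermitian B"
    using A by (simp add: hermitian_def Bv cinner_diff_left cinner_diff_right cinner_scaleR_left
        cinner_scaleR_right)
  have "0 \<le> Re (cinner y (B *v y))" if "y \<in> S" for y
  proof (cases "y = 0")
    case False
    let ?u = "(1 / norm y) *\<^sub>R y"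
    have "?u \<in> S" "norm ?u = 1"
      using False that vec_subspace_imp_subspace[OF S] by (simp_all add: subspace_scale)
    from max[OF this] have "Re (cinner y (A *v y)) / (norm y)\<^sup>2 \<le> l"
      by (simp add: matrix_vector_mult_scaleR_right cinner_scaleR_left cinner_scaleR_right
          l_def power2_eq_square)
    then show ?thesis
      using False by (simp add: Bv cinner_diff_right cinner_scaleR_right cinner_self field_simps)
  qed simp
  moreover have "Re (cinner x (B *v x)) = 0"
    using x by (simp add: Bv cinner_diff_right cinner_scaleR_right cinner_self l_def)
  moreover have Bx: "B *v x \<in> S"
    using S x inv by (simp add: Bv scaleR_conv_scale vec.subspace_diff vec.subspace_scale)
  ultimately have "cinner (B *v x) (B *v x) = 0"
    using form_null_vector[OF herm S _ \<open>x \<in> S\<close>, of "B *v x"] by blast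
  then have "A *v x = of_real l *s x"
    by (simp add: Bv scaleR_conv_scale)
  with x show ?thesis by (rule that)
qed

text \<open>Induction on the dimension: the orthogonal complement T of an eigenvector within S is
  again invariant. A general S is allowed because the result is applied both to the whole space and
  to the range of a projection.\<close>

lemma hermitian_eigenbasis:
  fixes A :: "complex^'n^'n"
  assumes A: "hermitian A" and "vec.subspace S" and "\<And>x. x \<in> S \<Longrightarrow> A *v x \<in> S"
  shows "\<exists>w ev. orthonormal_basis_of (vec.dim S) w S \<and>
    (\<forall>j\<in>{1..vec.dim S}. A *v w j = of_real (ev j) *s w j)"
  using assms(2-)
proof (induction "vec.dim S" arbitrary: S)
  case 0
  then have "S = {0}"
    using vec.dim_eq_0[of S] vec.subspace_0 by auto
  then show ?case
    using 0 by (simp add: orthonormal_basis_of_def)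
next
  case (Suc d)
  then have "S \<noteq> {0}" by auto
  then obtain x \<mu> where x: "x \<in> S" "norm x = 1" "A *v x = of_real \<mu> *s x"
    using hermitian_eigenvector[OF A] Suc.prems by blast
  define T where "T = {y \<in> S. cinner x y = 0}"
  have T: "vec.subspace T"
    using Suc.prems(1) by (auto simp: T_def vec.subspace_def cinner_add_right cinner_scale_right)
  have invT: "A *v y \<in> T" if "y \<in> T" for y
    using that Suc.prems(2)
    by (auto simp: T_def x cinner_scale_left hermitianD[OF A, symmetric])
  have S_eq: "S = vec.span (insert x T)"
  proof
    show "S \<subseteq> vec.span (insert x T)"
    proof
      fix y assume "y \<in> S"
      have "y - cinner x y *s x \<in> T"
        using \<open>y \<in> S\<close> x Suc.prems(1)
        by (simp add: T_def vec.subspace_diff vec.subspace_scale cinner_diff_right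
            cinner_scale_right cinner_self)
      then have "(y - cinner x y *s x) + cinner x y *s x \<in> vec.span (insert x T)"
        by (intro vec.span_add vec.span_scale) (auto intro: vec.span_base)
      then show "y \<in> vec.span (insert x T)" by simp
    qed
    show "vec.span (insert x T) \<subseteq> S"
      using x Suc.prems(1) by (intro vec.span_minimal) (auto simp: T_def)
  qed
  have "x \<notin> vec.span T"
    using x T vec.span_eq_iff[of T] by (simp add: T_def cinner_self del: vec.span_eq_iff)
  then have d: "vec.dim T = d"
    using Suc.hyps(2) unfolding S_eq vec.dim_span vec.dim_insert by simp
  obtain w ev where w: "orthonormal_basis_of d w T" "\<forall>j\<in>{1..d}. A *v w j = of_real (ev j) *s w j"
    using Suc.hyps(1)[OF _ T invT] d by auto
  define w' where "w' = w(Suc d := x)"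
  have wT: "cinner x (w j) = 0" "cinner (w j) x = 0" if "j \<in> {1..d}" for j
  proof -
    have "w j \<in> T"
      using w(1) that by (auto simp: orthonormal_basis_of_def intro: vec.span_base)
    then show "cinner x (w j) = 0" by (simp add: T_def)
    then show "cinner (w j) x = 0" by (metis cnj_cinner complex_cnj_zero)
  qed
  have I: "{1..Suc d} = insert (Suc d) {1..d}" by auto
  have im: "w' ` {1..Suc d} = insert x (w ` {1..d})"
    unfolding I by (auto simp: w'_def)
  have "vec.span (insert x (w ` {1..d})) = S"
  proof -
    have "vec.span (w ` {1..d}) = T"
      using w(1) by (simp add: orthonormal_basis_of_def)
    moreover have "vec.span T = T"
      using T by (simp add: vec.span_eq_iff)
    ultimately show ?thesis
      unfolding S_eq vec.span_insert by (simp only:)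
  qed
  moreover have "cinner x x = 1"
    using x by (simp add: cinner_self)
  then have "cinner (w' j) (w' k) = (if j = k then 1 else 0)"
    if "j \<in> {1..Suc d}" "k \<in> {1..Suc d}" for j k
    using that w(1) wT x unfolding I
    by (auto simp: w'_def orthonormal_basis_of_def)
  ultimately have "orthonormal_basis_of (Suc d) w' S"
    unfolding orthonormal_basis_of_def im by simp
  moreover have "\<forall>j\<in>{1..Suc d}. A *v w' j = of_real ((ev(Suc d := \<mu>)) j) *s w' j"
    using w(2) x unfolding I by (auto simp: w'_def)
  ultimately show ?case
    by (intro exI[of _ w'] exI[of _ "ev(Suc d := \<mu>)"]) (simp only: Suc.hyps(2)[symmetric])
qed

lemma orthonormal_basis_mem: "orthonormal_basis_of d w S \<Longrightarrow> j \<in> {1..d} \<Longrightarrow> w j \<in> S"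
  unfolding orthonormal_basis_of_def by (metis imageI vec.span_base)

lemma orthonormal_expansion:
  assumes w: "orthonormal_basis_of d w S" and "x \<in> S"
  shows "x = (\<Sum>j=1..d. cinner (w j) x *s w j)"
proof -
  have "x \<in> vec.span (w ` {1..d})"
    using assms by (simp add: orthonormal_basis_of_def)
  then show ?thesis
  proof (induction rule: vec.span_induct_alt)
    case base
    then show ?case by simp
  next
    case (step c z y)
    then obtain k where k: "k \<in> {1..d}" "z = w k" by auto
    have "(\<Sum>j=1..d. cinner (w j) z *s w j) = (\<Sum>j=1..d. if j = k then w k else 0)"
      using w k by (intro sum.cong) (auto simp: orthonormal_basis_of_def)
    also have "\<dots> = z" using k by simp
    finally have z: "z = (\<Sum>j=1..d. cinner (w j) z *s w j)" by simp
    have "(\<Sum>j=1..d. cinner (w j) (c *s z + y) *s w j)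
        = c *s (\<Sum>j=1..d. cinner (w j) z *s w j) + (\<Sum>j=1..d. cinner (w j) y *s w j)"
      by (simp add: cinner_add_right cinner_scale_right vec.scale_sum_right sum.distrib
          vec.scale_left_distrib)
    then show ?case using z step.IH by simp
  qed
qed

text \<open>Spectral decomposition with the square roots of the eigenvalues absorbed into the
  vectors; some of these may be zero.\<close>

lemma psd_decomposition:
  fixes A :: "complex^'n^'n"
  assumes "psd A"
  obtains d v where "A = (\<Sum>j=1..d::nat. ketbra (v j) (v j))"
proof -
  obtain d w ev where w: "orthonormal_basis_of d w UNIV"
    and ev: "\<And>j. j \<in> {1..d} \<Longrightarrow> A *v w j = of_real (ev j) *s w j"
    using hermitian_eigenbasis[OF psd_hermitian[OF assms], of UNIV] vec.subspace_UNIV by blast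
  have nn: "0 \<le> ev j" if "j \<in> {1..d}" for j
    using psd_nonneg[OF assms, of "w j"] w that
    by (simp add: ev cinner_scale_right orthonormal_basis_of_def)
  have "A *v x = (\<Sum>j=1..d. ketbra (sqrt (ev j) *\<^sub>R w j) (sqrt (ev j) *\<^sub>R w j)) *v x" for x
  proof -
    have "A *v x = (\<Sum>j=1..d. A *v (cinner (w j) x *s w j))"
      using orthonormal_expansion[OF w UNIV_I, of x] by (metis matrix_vector_mult_sum_right)
    also have "\<dots> = (\<Sum>j=1..d. ketbra (sqrt (ev j) *\<^sub>R w j) (sqrt (ev j) *\<^sub>R w j) *v x)"
    proof (rule sum.cong[OF refl])
      fix j assume j: "j \<in> {1..d}"
      have "complex_of_real (sqrt (ev j)) * complex_of_real (sqrt (ev j)) = of_real (ev j)"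
        using nn[OF j] by (simp flip: of_real_mult)
      then show "A *v (cinner (w j) x *s w j) =
          ketbra (sqrt (ev j) *\<^sub>R w j) (sqrt (ev j) *\<^sub>R w j) *v x"
        using j by (simp add: ketbra_mult_vec matrix_vector_mult_scale ev cinner_scale_left
            scaleR_conv_scale mult.commute mult.left_commute mult.assoc)
    qed
    finally show ?thesis by (simp add: matrix_vector_mult_sum_left)
  qed
  then have "A = (\<Sum>j=1..d. ketbra (sqrt (ev j) *\<^sub>R w j) (sqrt (ev j) *\<^sub>R w j))"
    by (simp add: matrix_eq)
  then show ?thesis by (rule that)
qed

section \<open>Traces of products of positive semidefinite matrices\<close>

lemma trace_mult_ketbra_sum:
  "trace (A ** (\<Sum>j\<in>J. ketbra (v j) (v j))) = (\<Sum>j\<in>J. cinner (v j) (A *v v j))"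
  by (simp add: matrix_mult_sum_right trace_sum mult_ketbra trace_ketbra)

lemma psd_trace_mult_nonneg:
  assumes "psd A" "psd B"
  shows "0 \<le> Re (trace (A ** B))"
proof -
  obtain d v where "B = (\<Sum>j=1..d::nat. ketbra (v j) (v j))"
    using psd_decomposition[OF \<open>psd B\<close>] by blast
  then show ?thesis
    by (simp add: trace_mult_ketbra_sum sum_nonneg psd_nonneg[OF \<open>psd A\<close>])
qed

text \<open>With B a sum of |v_j><v_j|, the trace is a sum of nonnegative values of the form of A at
  the v_j. If it vanishes, so does every A v_j by \<open>psd_null_vector\<close>, and with it every
  term of A B.\<close>

lemma psd_trace_mult_eq_0:
  assumes "psd A" "psd B" and zero: "Re (trace (A ** B)) = 0"
  shows "A ** B = 0"
proof -
  obtain d v where B: "B = (\<Sum>j=1..d::nat. ketbra (v j) (v j))"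
    using psd_decomposition[OF \<open>psd B\<close>] by blast
  have "\<forall>j\<in>{1..d}. Re (cinner (v j) (A *v v j)) = 0"
    using zero psd_nonneg[OF \<open>psd A\<close>] by (simp add: B trace_mult_ketbra_sum sum_nonneg_eq_0_iff)
  then have "\<forall>j\<in>{1..d}. A *v v j = 0"
    using psd_null_vector[OF \<open>psd A\<close>] by blast
  then have "A ** B = (\<Sum>j=1..d. ketbra 0 (v j))"
    unfolding B matrix_mult_sum_right mult_ketbra by (intro sum.cong) auto
  also have "\<dots> = 0" by (simp add: ketbra_def vec_eq_iff sum.neutral zero_vec_def)
  finally show ?thesis .
qed

section \<open>Optimal measurements\<close>

definition weighted_state :: "'n::finite ensemble \<Rightarrow> nat \<Rightarrow> complex^'n^'n" where
  "weighted_state P i = fst (P i) *\<^sub>R snd (P i)"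

lemma success_prob_eq: "success_prob m P M = (\<Sum>i=1..m. Re (trace (weighted_state P i ** M i)))"
proof -
  have "weighted_state P i ** M i = fst (P i) *\<^sub>R (snd (P i) ** M i)" for i
    by (simp add: weighted_state_def matrix_eq matrix_vector_mul_assoc[symmetric]
        matrix_vector_mult_scaleR_left)
  then show ?thesis by (simp add: success_prob_def trace_scaleR)
qed

lemma povm_hermitian: "povm m M \<Longrightarrow> i \<in> {1..m} \<Longrightarrow> hermitian (M i)"
  by (simp add: povm_def psd_hermitian)

lemma povm_sum_vec: "povm m M \<Longrightarrow> (\<Sum>i=1..m. M i *v x) = x"
  by (simp add: povm_def flip: matrix_vector_mult_sum_left)

section \<open>Existence of an optimal measurement by compactness\<close>

lemma psd_entry_bound:
  assumes "psd A"
  shows "2 * cmod (A $ k $ l) \<le> Re (A $ k $ k) + Re (A $ l $ l)"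
proof -
  \<comment> \<open>A phase that rotates the entry to its modulus; the form is then evaluated at e_k
    - c e_l. The value 1 for a vanishing entry keeps c unimodular.\<close>
  define c where "c = (if A $ k $ l = 0 then 1 else cnj (sgn (A $ k $ l)))"
  have c: "cnj c * c = 1" "c * A $ k $ l = of_real (cmod (A $ k $ l))"
    by (auto simp: c_def complex_sgn_def norm_divide complex_norm_square[symmetric]
        scaleR_conv_of_real sgn_div_norm mult.commute power2_eq_square divide_simps
        simp flip: of_real_mult of_real_power)
  let ?x = "axis k 1 :: complex^'a" and ?y = "axis l 1 :: complex^'a"
  have lk: "A $ l $ k = cnj (A $ k $ l)"
    by (metis cinner_axis_mult_axis cnj_cinner hermitianD psd_hermitian assms)
  have "0 \<le> Re (cinner (?x - c *s ?y) (A *v (?x - c *s ?y)))"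
    by (rule psd_nonneg[OF assms])
  also have "cinner (?x - c *s ?y) (A *v (?x - c *s ?y)) =
      A $ k $ k - c * A $ k $ l - cnj (c * A $ k $ l) + cnj c * c * A $ l $ l"
    by (simp add: matrix_vector_mult_diff_distrib matrix_vector_mult_scale cinner_diff_left
        cinner_diff_right cinner_scale_left cinner_scale_right cinner_axis_mult_axis lk algebra_simps)
  finally show ?thesis unfolding c by simp
qed

text \<open>At each diagonal position the entries are nonnegative and add up to 1 over the
  measurement; \<open>psd_entry_bound\<close> carries the bound to the other positions.\<close>

lemma povm_entry_bound:
  assumes M: "povm m M" and i: "i \<in> {1..m}"
  shows "cmod (M i $ k $ l) \<le> 1"
proof -
  have diag: "Re (M i $ k $ k) \<le> 1" for k
  proof -
    have "0 \<le> Re (M j $ k $ k)" if "j \<in> {1..m}" for j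
    proof -
      have "0 \<le> 2 * cmod (M j $ k $ k)" by simp
      also have "\<dots> \<le> Re (M j $ k $ k) + Re (M j $ k $ k)"
        using psd_entry_bound[of "M j" k k] M that by (simp add: povm_def)
      finally show ?thesis by simp
    qed
    then have "Re (M i $ k $ k) \<le> (\<Sum>j=1..m. Re (M j $ k $ k))"
      using i by (intro member_le_sum) auto
    also have "\<dots> = Re ((\<Sum>j=1..m. M j) $ k $ k)" by simp
    also have "\<dots> = 1" using M by (simp add: povm_def mat_def)
    finally show ?thesis .
  qed
  show ?thesis
    using psd_entry_bound[of "M i" k l] diag[of k] diag[of l] M i by (auto simp: povm_def)
qed

lemma povm_norm_bound:
  fixes M :: "nat \<Rightarrow> complex^'n^'n"
  assumes "povm m M" "i \<in> {1..m}"
  shows "norm (M i) \<le> (CARD('n))\<^sup>2"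
proof -
  have "norm (M i) \<le> (\<Sum>k\<in>UNIV. norm (M i $ k))"
    by (simp add: norm_vec_def L2_set_le_sum)
  also have "\<dots> \<le> (\<Sum>k\<in>(UNIV :: 'n set). \<Sum>l\<in>(UNIV :: 'n set). norm (M i $ k $ l))"
    by (intro sum_mono) (simp add: norm_vec_def L2_set_le_sum)
  also have "\<dots> \<le> (\<Sum>k\<in>(UNIV :: 'n set). \<Sum>l\<in>(UNIV :: 'n set). 1)"
    by (intro sum_mono povm_entry_bound[OF assms])
  finally show ?thesis by (simp add: power2_eq_square)
qed

text \<open>A closed subset of a product of closed balls and singletons, compact by Tychonoff. The
  components outside the index range are pinned to 0, since free coordinates would destroy
  compactness.\<close>

lemma compact_povms:
  "compact {M. povm m M \<and> (\<forall>i. i \<notin> {1..m} \<longrightarrow> M i = (0 :: complex^'n^'n))}" (is "compact ?C")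
proof -
  define B where "B i = (if i \<in> {1..m} then cball (0 :: complex^'n^'n) ((CARD('n))\<^sup>2) else {0})" for i
  have "compactin (product_topology (\<lambda>_. euclidean) UNIV) (PiE UNIV B)"
    by (subst compactin_PiE) (auto simp: compactin_euclidean_iff B_def)
  then have "compact (PiE UNIV B)"
    by (simp add: euclidean_product_topology compactin_euclidean_iff)
  have "closed ?C"
  proof -
    have cont: "continuous_on UNIV (\<lambda>M::nat \<Rightarrow> complex^'n^'n. M i)" for i
      by (rule continuous_on_product_coordinates)
    have "?C = (\<Inter>i\<in>{1..m}. \<Inter>x. {M. cinner x (M i *v x) \<in> \<real>\<^sub>\<ge>\<^sub>0}) \<inter>
        {M. (\<Sum>i=1..m. M i) = mat 1} \<inter> (\<Inter>i\<in>-{1..m}. {M. M i = 0})"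
      by (auto simp: povm_def psd_def)
    moreover have "closed {M::nat \<Rightarrow> complex^'n^'n. cinner x (M i *v x) \<in> \<real>\<^sub>\<ge>\<^sub>0}" for x i
      using closed_vimage[OF closed_nonneg_Reals_complex continuous_on_cinner[OF continuous_on_const
          continuous_on_matrix_vector_mult[OF cont continuous_on_const]], of x i x]
      by (simp add: vimage_def)
    moreover have "closed {M::nat \<Rightarrow> complex^'n^'n. (\<Sum>i=1..m. M i) = mat 1}"
      by (intro closed_Collect_eq continuous_on_sum cont continuous_on_const)
    moreover have "closed {M::nat \<Rightarrow> complex^'n^'n. M i = 0}" for i
      by (intro closed_Collect_eq cont continuous_on_const)
    ultimately show ?thesis by (auto intro!: closed_Int closed_INT)
  qed
  with \<open>compact (PiE UNIV B)\<close> have "compact (PiE UNIV B \<inter> ?C)"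
    by (rule compact_Int_closed)
  moreover have "?C \<subseteq> PiE UNIV B"
    using povm_norm_bound[where 'n = 'n] by (auto simp: B_def)
  ultimately show ?thesis
    by (simp only: inf.absorb2)
qed

lemma continuous_on_trace_mult:
  fixes A :: "complex^'n^'n"
  shows "continuous_on S f \<Longrightarrow> continuous_on S (\<lambda>x. trace (A ** f x))"
  unfolding trace_def matrix_matrix_mult_def by (simp, intro continuous_intros)

text \<open>For m = 0 the empty sum is not the identity and no measurement exists; otherwise the one
  that always answers 1 shows that the compact set is nonempty.\<close>

lemma optimal_povm_exists:
  fixes P :: "'n::finite ensemble"
  assumes "1 \<le> m"
  obtains M where "optimal_povm m P M"
proof -
  let ?C = "{M. povm m M \<and> (\<forall>i. i \<notin> {1..m} \<longrightarrow> M i = (0 :: complex^'n^'n))}"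
  have "psd (0 :: complex^'n^'n)" "psd (mat 1 :: complex^'n^'n)"
    by (simp_all add: psd_def cinner_self del: of_real_power)
  moreover have "(\<Sum>i=1..m. if i = 1 then mat 1 else 0 :: complex^'n^'n) = mat 1"
    using assms by simp
  ultimately have "(\<lambda>i. if i = 1 then mat 1 else 0) \<in> ?C"
    using assms by (simp add: povm_def)
  then have ne: "?C \<noteq> {}" by blast
  have "continuous_on UNIV (success_prob m P)"
    unfolding success_prob_def
    by (intro continuous_on_sum continuous_on_mult continuous_on_const continuous_on_Re
        continuous_on_trace_mult continuous_on_product_coordinates)
  then have cont: "continuous_on ?C (success_prob m P)"
    by (rule continuous_on_subset) simp
  obtain M where M: "M \<in> ?C" "\<forall>M'\<in>?C. success_prob m P M' \<le> success_prob m P M"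
    using continuous_attains_sup[OF compact_povms ne cont] by (elim bexE)
  have "success_prob m P M' \<le> success_prob m P M" if "povm m M'" for M'
  proof -
    define N where "N i = (if i \<in> {1..m} then M' i else 0)" for i
    have "N \<in> ?C" using that by (simp add: N_def povm_def)
    from bspec[OF M(2) this] show ?thesis
      by (simp add: success_prob_def N_def)
  qed
  with M(1) show ?thesis by (intro that[of M]) (simp add: optimal_povm_def)
qed

section \<open>First-order optimality conditions\<close>

lemma le_of_quadratic_perturbation:
  fixes a b k s :: real
  assumes "0 \<le> a" "0 \<le> b" "0 \<le> s"
    and le: "\<And>e. 0 < e \<Longrightarrow> e * s \<le> 2 \<Longrightarrow> (2 * e - e\<^sup>2 * s) * a - 2 * e * k + e\<^sup>2 * b \<le> 0"
  shows "a \<le> k"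
proof (rule ccontr)
  assume "\<not> a \<le> k"
  then have d: "0 < a - k" by simp
  \<comment> \<open>The first bound gives e s <= 2, the second makes e s a smaller than a - k, so
    that the linear term 2 (a - k) dominates. The added ones avoid division by zero and make the
    second estimate strict.\<close>
  define e where "e = min (1 / (s + 1)) ((a - k) / (s * a + 1))"
  have sa: "0 \<le> s * a" using assms by simp
  have e: "0 < e" using d sa \<open>0 \<le> s\<close> by (simp add: e_def)
  have "e \<le> 1 / (s + 1)" by (simp add: e_def)
  with \<open>0 \<le> s\<close> have "e * (s + 1) \<le> 1" by (simp add: field_simps)
  with e have es: "e * s \<le> 2" by (simp add: algebra_simps)
  have "e \<le> (a - k) / (s * a + 1)" by (simp add: e_def)
  with sa have "e * (s * a + 1) \<le> a - k" by (simp add: field_simps)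
  with e have esa: "e * (s * a) < a - k" by (simp add: algebra_simps)
  have "e * (2 * (a - k) - e * (s * a) + e * b) \<le> 0"
    using le[OF e es] by (simp add: algebra_simps power2_eq_square)
  with e have "2 * (a - k) - e * (s * a) + e * b \<le> 0"
    by (simp add: mult_le_0_iff)
  moreover have "0 \<le> e * b" using e assms by simp
  ultimately show False using esa d by (smt (verit))
qed

lemma hermitian_sandwich:
  fixes e :: real and x :: "complex^'n"
  assumes M: "hermitian M"
  defines "E \<equiv> mat 1 - e *\<^sub>R ketbra x x"
  shows "E ** M ** E = M - e *\<^sub>R ketbra (M *v x) x - e *\<^sub>R ketbra x (M *v x)
    + (e\<^sup>2 * Re (cinner x (M *v x))) *\<^sub>R ketbra x x"
proof -
  have Ev: "E *v v = v - (of_real e * cinner x v) *s x" for v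
    by (simp add: E_def matrix_vector_mult_diff_rdistrib matrix_vector_mult_scaleR_left
        ketbra_mult_vec scaleR_conv_scale)
  have xM: "cinner x (M *v v) = cinner (M *v x) v" for v
    using M by (simp add: hermitian_def)
  have "(E ** M ** E) *v v = (M - e *\<^sub>R ketbra (M *v x) x - e *\<^sub>R ketbra x (M *v x)
    + (e\<^sup>2 * Re (cinner x (M *v x))) *\<^sub>R ketbra x x) *v v" for v
    using hermitian_cinner_real[OF M, of x]
    by (simp add: matrix_vector_mul_assoc[symmetric] Ev matrix_vector_mult_diff_rdistrib
        matrix_vector_mult_add_rdistrib
        matrix_vector_mult_scaleR_left ketbra_mult_vec matrix_vector_mult_diff_distrib
        matrix_vector_mult_scale scaleR_conv_scale cinner_diff_right cinner_scale_right xM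
        vec_eq_iff algebra_simps power2_eq_square)
  then show ?thesis by (simp add: matrix_eq)
qed

lemma psd_sandwich:
  assumes "psd M" "hermitian E"
  shows "psd (E ** M ** E)"
  using assms by (simp add: psd_def matrix_vector_mul_assoc[symmetric] hermitian_def)

lemma psd_scaleR: "psd A \<Longrightarrow> 0 \<le> c \<Longrightarrow> psd (c *\<^sub>R A)"
  by (simp add: psd_def matrix_vector_mult_scaleR_left cinner_scaleR_right nonneg_Reals_mult_I)

lemma psd_add: "psd A \<Longrightarrow> psd B \<Longrightarrow> psd (A + B)"
  by (simp add: psd_def matrix_vector_mult_add_rdistrib cinner_add_right nonneg_Reals_add_I)

lemma psd_ketbra: "psd (ketbra x x)"
  using psd_ketbra_sum[where J = "{()}" and v = "\<lambda>_. x"] by simp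

lemma hermitian_identity_minus_ketbra: "hermitian (mat 1 - e *\<^sub>R ketbra x x)"
  using psd_hermitian[OF psd_ketbra, of x]
  by (intro hermitian_diff)
    (auto simp: hermitian_def matrix_vector_mult_scaleR_left cinner_scaleR_left cinner_scaleR_right)

text \<open>The two terms linear in e are complex conjugates of each other, whence the factor 2 and
  the real part.\<close>

lemma trace_mult_sandwich:
  fixes e :: real and x :: "complex^'n"
  assumes "hermitian A" "hermitian M"
  defines "E \<equiv> mat 1 - e *\<^sub>R ketbra x x"
  shows "Re (trace (A ** (E ** M ** E))) = Re (trace (A ** M)) - 2 * e * Re (cinner (A *v x) (M *v x))
    + e\<^sup>2 * (Re (cinner x (M *v x)) * Re (cinner x (A *v x)))"
proof -
  have lin: "A ** (B - c *\<^sub>R C - d *\<^sub>R D + f *\<^sub>R F) =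
      A ** B - c *\<^sub>R (A ** C) - d *\<^sub>R (A ** D) + f *\<^sub>R (A ** F)" for B C D F c d f
    by (simp add: matrix_eq matrix_vector_mul_assoc[symmetric] algebra_simps
        matrix_vector_mult_scaleR_left matrix_vector_mult_scaleR_right)
  have "cinner x (A *v (M *v x)) = cinner (A *v x) (M *v x)"
    using assms(1) by (simp add: hermitian_def)
  then show ?thesis
    unfolding E_def hermitian_sandwich[OF assms(2)] lin
    by (simp add: trace_add trace_sub trace_scaleR mult_ketbra trace_ketbra
        Re_cinner_commute[of "M *v x"])
qed

text \<open>The dual variable for the constraint that the M_i sum to the identity. It is the
  Hermitian part of the sum of the A_i M_i: that this sum is itself Hermitian at an optimum is known
  only after complementary slackness.\<close>

definition lagrange_op :: "nat \<Rightarrow> (nat \<Rightarrow> complex^'n^'n) \<Rightarrow> (nat \<Rightarrow> complex^'n^'n) \<Rightarrow> complex^'n^'n" where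
  "lagrange_op m A M = (\<Sum>i=1..m. (1/2) *\<^sub>R (A i ** M i + M i ** A i))"

lemma hermitian_lagrange_op:
  assumes "\<And>i. i \<in> {1..m} \<Longrightarrow> hermitian (A i)" "\<And>i. i \<in> {1..m} \<Longrightarrow> hermitian (M i)"
  shows "hermitian (lagrange_op m A M)"
  unfolding hermitian_def lagrange_op_def
proof (intro allI)
  fix x y
  show "cinner x ((\<Sum>i=1..m. (1/2) *\<^sub>R (A i ** M i + M i ** A i)) *v y) =
      cinner ((\<Sum>i=1..m. (1/2) *\<^sub>R (A i ** M i + M i ** A i)) *v x) y"
    using assms
    by (simp add: matrix_vector_mult_sum_left cinner_sum_left cinner_sum_right cinner_scaleR_left
        cinner_scaleR_right matrix_vector_mult_scaleR_left matrix_vector_mult_add_rdistrib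
        cinner_add_left cinner_add_right matrix_vector_mul_assoc[symmetric] hermitian_def add.commute)
qed

lemma cinner_lagrange_op:
  assumes "\<And>i. i \<in> {1..m} \<Longrightarrow> hermitian (A i)" "\<And>i. i \<in> {1..m} \<Longrightarrow> hermitian (M i)"
  shows "Re (cinner x (lagrange_op m A M *v x)) = (\<Sum>i=1..m. Re (cinner (A i *v x) (M i *v x)))"
proof -
  have "Re (cinner x (((1/2) *\<^sub>R (A i ** M i + M i ** A i)) *v x)) = Re (cinner (A i *v x) (M i *v x))"
    if "i \<in> {1..m}" for i
    using assms[OF that] Re_cinner_commute[of "M i *v x" "A i *v x"]
    by (simp add: matrix_vector_mult_scaleR_left cinner_scaleR_right matrix_vector_mult_add_rdistrib
        cinner_add_right matrix_vector_mul_assoc[symmetric] hermitian_def)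
  then show ?thesis
    by (simp add: lagrange_op_def matrix_vector_mult_sum_left cinner_sum_right)
qed

text \<open>Absence of a duality gap: the right-hand side is the success probability, as
  \<open>complementary_slackness\<close> requires.\<close>

lemma trace_lagrange_op:
  "Re (trace (lagrange_op m A M)) = (\<Sum>i=1..m. Re (trace (A i ** M i)))"
  by (simp add: lagrange_op_def trace_sum trace_scaleR trace_add trace_mul_sym[of "M _" "A _"])

text \<open>Compare M with the measurements obtained from E M E, where E = 1 - e|x><x|, by
  adding the defect 1 - E^2 to the jth element; the inequality is the first order term in e.\<close>

lemma optimal_imp_lagrange_op_ge:
  fixes P :: "'n::finite ensemble"
  assumes opt: "optimal_povm m P M" and A: "\<And>i. i \<in> {1..m} \<Longrightarrow> psd (weighted_state P i)"
    and j: "j \<in> {1..m}"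
  shows "psd (lagrange_op m (weighted_state P) M - weighted_state P j)"
proof -
  let ?A = "weighted_state P"
  have M: "povm m M" and max: "\<And>M'. povm m M' \<Longrightarrow> success_prob m P M' \<le> success_prob m P M"
    using opt by (auto simp: optimal_povm_def)
  note herm = psd_hermitian[OF A] povm_hermitian[OF M]
  have "Re (cinner x (?A j *v x)) \<le> Re (cinner x (lagrange_op m ?A M *v x))" for x
  proof (rule le_of_quadratic_perturbation)
    define s where "s = Re (cinner x x)"
    define b where "b = (\<Sum>i=1..m. Re (cinner x (M i *v x)) * Re (cinner x (?A i *v x)))"
    show "0 \<le> Re (cinner x (?A j *v x))" by (rule psd_nonneg[OF A[OF j]])
    show "0 \<le> b"
      using M A by (auto simp: b_def povm_def intro!: sum_nonneg mult_nonneg_nonneg psd_nonneg)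
    show "0 \<le> s" by (simp add: s_def)
    fix e :: real assume e: "0 < e" "e * s \<le> 2"
    define E where "E = mat 1 - e *\<^sub>R ketbra x x"
    \<comment> \<open>With s the squared norm of x, E^2 = 1 - g |x><x|, so g |x><x| is the defect to
      be added. The bound e s <= 2 keeps it positive semidefinite.\<close>
    define g where "g = 2 * e - e\<^sup>2 * s"
    have "g = e * (2 - e * s)" by (simp add: g_def power2_eq_square algebra_simps)
    with e have g: "0 \<le> g" by simp
    define D where "D i = (if i = j then g *\<^sub>R ketbra x x else 0)" for i
    define N where "N i = E ** M i ** E + D i" for i
    have D_sum: "(\<Sum>i=1..m. D i) = g *\<^sub>R ketbra x x"
      using j by (simp add: D_def)
    have "E ** E + g *\<^sub>R ketbra x x = mat 1"
    proof -
      have "of_real s = cinner x x" by (simp add: s_def cinner_self)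
      then have "(E ** E + g *\<^sub>R ketbra x x) *v v = mat 1 *v v" for v
        by (simp add: E_def g_def matrix_vector_mul_assoc[symmetric] matrix_vector_mult_diff_rdistrib
            matrix_vector_mult_add_rdistrib matrix_vector_mult_scaleR_left ketbra_mult_vec
            scaleR_conv_scale cinner_diff_right cinner_scale_right vec_eq_iff algebra_simps
            power2_eq_square)
      then show ?thesis by (simp add: matrix_eq)
    qed
    moreover have "(\<Sum>i=1..m. E ** M i ** E) = E ** E"
      using M by (simp add: povm_def flip: matrix_mult_sum_left matrix_mult_sum_right)
    ultimately have "(\<Sum>i=1..m. N i) = mat 1"
      by (simp only: N_def sum.distrib D_sum)
    moreover have "psd (N i)" if "i \<in> {1..m}" for i
    proof -
      have "psd (D i)"
        using g psd_ketbra_sum[where J = "{}"] by (auto simp: D_def intro: psd_scaleR psd_ketbra)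
      moreover have "psd (E ** M i ** E)"
        using M that by (auto simp: povm_def E_def intro: psd_sandwich hermitian_identity_minus_ketbra)
      ultimately show ?thesis by (simp add: N_def psd_add)
    qed
    ultimately have "success_prob m P N \<le> success_prob m P M"
      by (intro max) (simp add: povm_def)
    moreover have "success_prob m P N = success_prob m P M
        - 2 * e * Re (cinner x (lagrange_op m ?A M *v x)) + e\<^sup>2 * b + g * Re (cinner x (?A j *v x))"
    proof -
      have "(\<Sum>i=1..m. Re (trace (?A i ** D i))) = (\<Sum>i=1..m. if i = j then g * Re (cinner x (?A i *v x)) else 0)"
      proof (intro sum.cong refl)
        fix i
        have "?A i ** (g *\<^sub>R ketbra x x) = g *\<^sub>R (?A i ** ketbra x x)"
          by (simp add: matrix_eq matrix_vector_mul_assoc[symmetric]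
              matrix_vector_mult_scaleR_left matrix_vector_mult_scaleR_right)
        then show "Re (trace (?A i ** D i)) = (if i = j then g * Re (cinner x (?A i *v x)) else 0)"
          by (auto simp: D_def trace_scaleR mult_ketbra trace_ketbra)
            (simp add: trace_def matrix_matrix_mult_def)
      qed
      also have "\<dots> = g * Re (cinner x (?A j *v x))" using j by simp
      finally have D: "(\<Sum>i=1..m. Re (trace (?A i ** D i))) = g * Re (cinner x (?A j *v x))" .
      have L: "Re (cinner x (lagrange_op m ?A M *v x)) = (\<Sum>i=1..m. Re (cinner (?A i *v x) (M i *v x)))"
        by (rule cinner_lagrange_op) (simp_all only: herm)
      have "success_prob m P N = (\<Sum>i=1..m. Re (trace (?A i ** (E ** M i ** E))))
          + g * Re (cinner x (?A j *v x))"
        by (simp add: success_prob_eq N_def matrix_add_ldistrib trace_add sum.distrib D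
            del: One_nat_def)
      also have "(\<Sum>i=1..m. Re (trace (?A i ** (E ** M i ** E)))) = (\<Sum>i=1..m. Re (trace (?A i ** M i))
          - 2 * e * Re (cinner (?A i *v x) (M i *v x))
          + e\<^sup>2 * (Re (cinner x (M i *v x)) * Re (cinner x (?A i *v x))))"
        unfolding E_def by (intro sum.cong refl trace_mult_sandwich herm) auto
      finally show ?thesis
        using L
        by (simp add: success_prob_eq sum.distrib sum_subtractf b_def sum_distrib_left
            del: One_nat_def)
    qed
    ultimately show "(2 * e - e\<^sup>2 * s) * Re (cinner x (?A j *v x))
        - 2 * e * Re (cinner x (lagrange_op m ?A M *v x)) + e\<^sup>2 * b \<le> 0"
      by (simp add: g_def)
  qed
  then show ?thesis
    using hermitian_diff[OF hermitian_lagrange_op[OF herm] herm(1)[OF j]]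
    by (simp add: psd_iff_hermitian matrix_vector_mult_diff_rdistrib cinner_diff_right)
qed

text \<open>The traces of (K - A_i) M_i are nonnegative and add up to tr K minus the sum of the tr
  (A_i M_i), which is 0. So each vanishes, and \<open>psd_trace_mult_eq_0\<close> makes the products
  themselves vanish.\<close>

lemma complementary_slackness:
  assumes K: "\<And>i. i \<in> {1..m} \<Longrightarrow> psd (K - A i)" and M: "povm m M"
    and tr: "Re (trace K) = (\<Sum>i=1..m. Re (trace (A i ** M i)))" and i: "i \<in> {1..m}"
  shows "K ** M i = A i ** M i"
proof -
  have dist: "(K - A i) ** M i = K ** M i - A i ** M i" for i
    by (simp add: matrix_eq matrix_vector_mul_assoc[symmetric] matrix_vector_mult_diff_rdistrib)
  have "trace K = (\<Sum>i=1..m. trace (K ** M i))"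
    using M by (simp add: povm_def flip: trace_sum matrix_mult_sum_right)
  then have "(\<Sum>i=1..m. Re (trace ((K - A i) ** M i))) = 0"
    using tr by (simp add: dist trace_sub sum_subtractf)
  moreover have "0 \<le> Re (trace ((K - A i) ** M i))" if "i \<in> {1..m}" for i
    using K M that by (intro psd_trace_mult_nonneg) (auto simp: povm_def)
  ultimately have "Re (trace ((K - A i) ** M i)) = 0"
    using i by (subst (asm) sum_nonneg_eq_0_iff) auto
  then have "(K - A i) ** M i = 0"
    using K M i by (intro psd_trace_mult_eq_0) (auto simp: povm_def)
  then show ?thesis by (simp add: dist)
qed

text \<open>The Karush-Kuhn-Tucker conditions of the discrimination problem as a semidefinite
  program: primal feasibility, dual feasibility and complementary slackness.\<close>

definition kkt_point :: "nat \<Rightarrow> (nat \<Rightarrow> complex^'n^'n) \<Rightarrow> complex^'n^'n \<Rightarrow> (nat \<Rightarrow> complex^'n^'n) \<Rightarrow> bool"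
  where "kkt_point m A K M \<longleftrightarrow> povm m M \<and> hermitian K \<and>
    (\<forall>i\<in>{1..m}. psd (K - A i) \<and> K ** M i = A i ** M i)"

text \<open>K is built from one optimal M, yet it fits every other optimal N: both have the same
  success probability, so the trace identity behind slackness holds for N too.
  \<open>kkt_unique\<close> relies on this common K.\<close>

lemma optimal_kkt_point:
  fixes P :: "'n::finite ensemble"
  assumes A: "\<And>i. i \<in> {1..m} \<Longrightarrow> psd (weighted_state P i)"
  obtains K where "\<And>M. optimal_povm m P M \<Longrightarrow> kkt_point m (weighted_state P) K M"
proof (cases "\<exists>M. optimal_povm m P M")
  case True
  then obtain M where M: "optimal_povm m P M" by blast
  define K where "K = lagrange_op m (weighted_state P) M"
  have "kkt_point m (weighted_state P) K N" if N: "optimal_povm m P N" for N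
  proof -
    have povm: "povm m M" "povm m N" using M N by (auto simp: optimal_povm_def)
    have ge: "psd (K - weighted_state P i)" if "i \<in> {1..m}" for i
      unfolding K_def using M A that by (rule optimal_imp_lagrange_op_ge)
    have "success_prob m P N = success_prob m P M"
      using M N by (intro antisym) (simp_all add: optimal_povm_def)
    then have "Re (trace K) = (\<Sum>i=1..m. Re (trace (weighted_state P i ** N i)))"
      by (simp add: K_def trace_lagrange_op success_prob_eq)
    from complementary_slackness[OF ge povm(2) this] ge show ?thesis
      using hermitian_lagrange_op[OF psd_hermitian[OF A] povm_hermitian[OF povm(1)]] povm(2)
      by (simp add: kkt_point_def K_def)
  qed
  then show ?thesis by (rule that)
qed (use that in blast)

section \<open>Rank and support\<close>

definition cnjv :: "complex^'n \<Rightarrow> complex^'n" where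
  "cnjv x = (\<chi> k. cnj (x $ k))"

lemma cnjv_cnjv [simp]: "cnjv (cnjv x) = x"
  by (simp add: cnjv_def vec_eq_iff)

lemma cnjv_span: "x \<in> vec.span S \<Longrightarrow> cnjv x \<in> vec.span (cnjv ` S)"
proof (induction rule: vec.span_induct_alt)
  case base
  have "cnjv 0 = (0 :: complex^'a)" by (simp add: cnjv_def vec_eq_iff)
  then show ?case by (simp add: vec.span_zero)
next
  case (step c x y)
  have "cnjv (c *s x + y) = cnj c *s cnjv x + cnjv y"
    by (simp add: cnjv_def vec_eq_iff)
  then show ?case
    using step by (simp add: vec.span_add vec.span_scale vec.span_base)
qed

text \<open>Conjugation is semilinear. It sends a basis to a spanning set of no greater size, and as
  an involution it gives the reverse inequality as well.\<close>

lemma dim_cnjv_image: "vec.dim (cnjv ` S) = vec.dim S"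
proof -
  have le: "vec.dim (cnjv ` S) \<le> vec.dim S" for S :: "(complex^'n) set"
  proof -
    obtain B where B: "vec.independent B" "S \<subseteq> vec.span B" "card B = vec.dim S"
      by (rule vec.basis_exists)
    have "cnjv ` S \<subseteq> vec.span (cnjv ` B)"
      using B(2) cnjv_span by auto
    then have "vec.dim (cnjv ` S) \<le> card (cnjv ` B)"
      using vec.finiteI_independent[OF B(1)] by (intro vec.dim_le_card) auto
    also have "\<dots> \<le> vec.dim S"
      unfolding B(3)[symmetric] using vec.finiteI_independent[OF B(1)] by (rule card_image_le)
    finally show ?thesis .
  qed
  have "cnjv ` cnjv ` S = S" by (simp add: image_image)
  then show ?thesis using le[of S] le[of "cnjv ` S"] by simp
qed

text \<open>The library defines rank as row rank, and relates it to the dimension of the range only over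
  the reals. For a Hermitian matrix the columns are the conjugates of the rows.\<close>

lemma rank_hermitian:
  fixes A :: "complex^'n^'n"
  assumes "hermitian A"
  shows "rank A = vec.dim (range ((*v) A))"
proof -
  have "cnj (A $ l $ k) = A $ k $ l" for k l
    using assms by (metis cinner_axis_mult_axis cnj_cinner hermitianD)
  then have "column k A = cnjv (row k A)" for k
    by (simp add: column_def row_def cnjv_def vec_eq_iff)
  then have "columns A = cnjv ` rows A"
    by (auto simp: columns_def rows_def)
  then have "rank A = vec.dim (columns A)"
    by (simp add: row_rank_def_gen dim_cnjv_image)
  also have "\<dots> = vec.dim (range ((*v) A))"
  proof (rule antisym)
    have "columns A \<subseteq> range ((*v) A)"
      by (auto simp: columns_def column_def vec_eq_iff image_iff
          cinner_axis_mult_axis[unfolded cinner_axis_left] intro!: exI[of _ "axis _ 1"])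
    then show "vec.dim (columns A) \<le> vec.dim (range ((*v) A))"
      by (rule vec.dim_subset)
    show "vec.dim (range ((*v) A)) \<le> vec.dim (columns A)"
      using matrix_vector_mult_in_columnspace_gen by (intro vec.dim_mono) blast
  qed
  finally show ?thesis .
qed

lemma hermitian_mult_in_supp: "hermitian A \<Longrightarrow> A *v x \<in> supp A"
  by (simp add: supp_def flip: hermitianD)

lemma subspace_supp: "vec.subspace (supp A)"
  by (auto simp: supp_def vec.subspace_def cinner_add_right cinner_scale_right)

text \<open>\<open>supp\<close> is the orthogonal complement of the kernel. For x in it, x - M x
  lies in the kernel, hence is orthogonal to x and to M x, hence to itself.\<close>

lemma supp_projection:
  assumes "hermitian M" and "\<And>x. M *v (M *v x) = M *v x"
  shows "supp M = range ((*v) M)" and "x \<in> supp M \<Longrightarrow> M *v x = x"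
proof -
  have fixed: "M *v x = x" if "x \<in> supp M" for x
  proof -
    have "M *v (x - M *v x) = 0"
      by (simp add: matrix_vector_mult_diff_distrib assms(2))
    then have "cinner (x - M *v x) x = 0" "cinner (x - M *v x) (M *v x) = 0"
      using that hermitianD[OF assms(1), of "x - M *v x" x] by (auto simp: supp_def)
    then have "cinner (x - M *v x) (x - M *v x) = 0"
      by (simp add: cinner_diff_right)
    then show ?thesis by simp
  qed
  then show "x \<in> supp M \<Longrightarrow> M *v x = x" .
  show "supp M = range ((*v) M)"
  proof
    show "supp M \<subseteq> range ((*v) M)" using fixed by (metis rangeI subsetI)
    show "range ((*v) M) \<subseteq> supp M" using hermitian_mult_in_supp[OF assms(1)] by auto
  qed
qed

text \<open>This removes the choice of the basis w from the value of the map.\<close>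

lemma sum_ketbra_orthonormal_basis:
  assumes M: "hermitian M" "\<And>x. M *v (M *v x) = M *v x"
    and w: "orthonormal_basis_of d w (supp M)"
  shows "(\<Sum>j=1..d. ketbra (w j) (w j)) = M"
proof -
  have "M *v x = (\<Sum>j=1..d. ketbra (w j) (w j)) *v x" for x
  proof -
    have "cinner (w j) (M *v x) = cinner (w j) x" if "j \<in> {1..d}" for j
    proof -
      have "w j \<in> supp M"
        using w that by (rule orthonormal_basis_mem)
      then show ?thesis
        using supp_projection(2)[OF M] hermitianD[OF M(1)] by metis
    qed
    then show ?thesis
      using orthonormal_expansion[OF w hermitian_mult_in_supp[OF M(1)], of x]
      by (simp add: matrix_vector_mult_sum_left ketbra_mult_vec)
  qed
  then show ?thesis by (simp add: matrix_eq)
qed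

lemma injective_imp_surj:
  fixes K :: "complex^'n^'n"
  assumes "\<And>x. K *v x = 0 \<Longrightarrow> x = 0"
  shows "inj ((*v) K)" "surj ((*v) K)"
proof -
  show "inj ((*v) K)"
  proof (rule injI)
    fix x y assume "K *v x = K *v y"
    then have "K *v (x - y) = 0" by (simp add: matrix_vector_mult_diff_distrib)
    then show "x = y" using assms by fastforce
  qed
  then show "surj ((*v) K)"
    by (intro vec.linear_inj_imp_surj) auto
qed

section \<open>Measurements satisfying the optimality conditions\<close>

text \<open>The A_i stand for weighted states. Traces are left free, so that two families may be
  compared up to a common factor.\<close>

locale independent_states =
  fixes m :: nat and A :: "nat \<Rightarrow> complex^'n^'n"
  assumes psd_A: "i \<in> {1..m} \<Longrightarrow> psd (A i)"
    and indep: "independent_subspaces {1..m} (\<lambda>i. supp (A i))"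
    and spanning: "vec.span (\<Union>i\<in>{1..m}. supp (A i)) = UNIV"
begin

lemma hermitian_A: "i \<in> {1..m} \<Longrightarrow> hermitian (A i)"
  by (simp only: psd_A psd_hermitian)

text \<open>Independence makes the decomposition into supports unique, and u already has one with a
  single component; \<open>v'\<close> below is the difference of the two.\<close>

lemma sum_in_supp:
  assumes v: "\<And>i. i \<in> {1..m} \<Longrightarrow> v i \<in> supp (A i)" and u: "(\<Sum>i=1..m. v i) = u" "u \<in> supp (A j)"
    and j: "j \<in> {1..m}" and i: "i \<in> {1..m}"
  shows "v i = (if i = j then u else 0)"
proof -
  define v' where "v' i = v i - (if i = j then u else 0)" for i
  have "\<forall>i\<in>{1..m}. v' i \<in> supp (A i)"
    using v u(2) by (auto simp: v'_def intro!: vec.subspace_diff[OF subspace_supp])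
  moreover have "(\<Sum>i=1..m. v' i) = 0"
    using j u by (simp add: v'_def sum_subtractf)
  ultimately have "\<forall>i\<in>{1..m}. v' i = 0"
    using indep unfolding independent_subspaces_def by metis
  with i show ?thesis by (simp add: v'_def)
qed

context
  fixes K :: "complex^'n^'n" and M :: "nat \<Rightarrow> complex^'n^'n"
  assumes kkt: "kkt_point m A K M"
begin

lemma kkt_vec: "i \<in> {1..m} \<Longrightarrow> A i *v (M i *v x) = K *v (M i *v x)"
  using kkt by (simp add: kkt_point_def matrix_vector_mul_assoc)

lemma kkt_hermitian: "hermitian K"
  using kkt by (simp add: kkt_point_def)

lemma kkt_povm: "povm m M"
  using kkt by (simp add: kkt_point_def)

lemma kkt_ge: "i \<in> {1..m} \<Longrightarrow> Re (cinner x (A i *v x)) \<le> Re (cinner x (K *v x))"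
  using kkt psd_nonneg[of "K - A i" x]
  by (simp add: kkt_point_def matrix_vector_mult_diff_rdistrib cinner_diff_right)

text \<open>If K x = 0, then 0 <= <x, A_i x> <= <x, K x> = 0, so A_i x = 0 for all i. Thus x is
  orthogonal to every support, and these span the space.\<close>

lemma kkt_nonsingular:
  assumes "K *v x = 0"
  shows "x = 0"
proof -
  have "A i *v x = 0" if i: "i \<in> {1..m}" for i
    using kkt_ge[OF i, of x] psd_nonneg[OF psd_A[OF i], of x] assms
    by (intro psd_null_vector[OF psd_A[OF i]]) simp
  then have "(\<Union>i\<in>{1..m}. supp (A i)) \<subseteq> {y. cinner x y = 0}"
    by (auto simp: supp_def)
  moreover have "vec.subspace {y. cinner x y = 0}"
    by (simp add: vec.subspace_def cinner_add_right cinner_scale_right)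
  ultimately have "vec.span (\<Union>i\<in>{1..m}. supp (A i)) \<subseteq> {y. cinner x y = 0}"
    by (rule vec.span_minimal)
  then have "x \<in> {y. cinner x y = 0}" unfolding spanning by blast
  then show ?thesis by simp
qed

lemma kkt_inj: "K *v x = K *v y \<longleftrightarrow> x = y"
  using injective_imp_surj(1)[of K] kkt_nonsingular by (simp add: inj_eq)

lemma kkt_surj: "\<exists>x. y = K *v x"
  using injective_imp_surj(2)[of K] kkt_nonsingular by (simp add: surj_def)

lemma kkt_psd:
  assumes "1 \<le> m"
  shows "psd K"
proof -
  have "0 \<le> Re (cinner x (K *v x))" for x
    using kkt_ge[of 1 x] psd_nonneg[OF psd_A, of 1 x] assms by simp
  then show ?thesis
    using kkt_hermitian by (simp add: psd_iff_hermitian)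
qed

text \<open>For y = N_j x slackness gives K y = A_j y, which lies in supp A_j. Two measurements are
  allowed: N = M yields orthogonal projections, a general N yields uniqueness.\<close>

lemma kkt_orthogonal:
  assumes N: "kkt_point m A K N" and i: "i \<in> {1..m}" and j: "j \<in> {1..m}"
  shows "M i *v (N j *v x) = (if i = j then N j *v x else 0)"
proof -
  let ?y = "N j *v x"
  have eq: "A i *v (M i *v ?y) = K *v (M i *v ?y)" if "i \<in> {1..m}" for i
    using kkt_vec[OF that] .
  have "A j *v ?y = K *v ?y"
    using N j by (simp add: kkt_point_def matrix_vector_mul_assoc)
  then have "K *v ?y \<in> supp (A j)"
    using hermitian_mult_in_supp[OF hermitian_A[OF j], of ?y] by simp
  moreover have "(\<Sum>i=1..m. K *v (M i *v ?y)) = K *v ?y"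
    using povm_sum_vec[OF kkt_povm, of ?y] by (simp flip: matrix_vector_mult_sum_right)
  moreover have "K *v (M i *v ?y) \<in> supp (A i)" if "i \<in> {1..m}" for i
    using hermitian_mult_in_supp[OF hermitian_A[OF that]] eq[OF that] by metis
  ultimately have "K *v (M i *v ?y) = (if i = j then K *v ?y else 0)"
    using i j by (intro sum_in_supp) auto
  then show ?thesis
    using kkt_inj kkt_nonsingular by (simp split: if_splits)
qed

lemma kkt_unique:
  assumes N: "kkt_point m A K N" and i: "i \<in> {1..m}"
  shows "M i = N i"
proof -
  have povm_N: "povm m N" using N by (simp add: kkt_point_def)
  have "M i *v x = N i *v x" for x
  proof -
    have "M i *v x = M i *v (\<Sum>j=1..m. N j *v x)"
      by (simp only: povm_sum_vec[OF povm_N])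
    also have "\<dots> = (\<Sum>j=1..m. if i = j then N j *v x else 0)"
      unfolding matrix_vector_mult_sum_right by (intro sum.cong refl kkt_orthogonal[OF N i])
    also have "\<dots> = N i *v x" using i by simp
    finally show ?thesis .
  qed
  then show ?thesis by (simp add: matrix_eq)
qed

lemma kkt_idem: "i \<in> {1..m} \<Longrightarrow> M i *v (M i *v x) = M i *v x"
  using kkt_orthogonal[OF kkt, of i i] by simp

lemma kkt_povm_hermitian: "i \<in> {1..m} \<Longrightarrow> hermitian (M i)"
  by (rule povm_hermitian[OF kkt_povm])

text \<open>Solve A_i x = K u. In the sum of the K M_j u only j = i survives, because K u lies in
  supp A_i; that term equals A_i M_i u.\<close>

lemma kkt_range:
  assumes i: "i \<in> {1..m}"
  shows "\<exists>u. A i *v x = A i *v (M i *v u)"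
proof -
  obtain u where u: "A i *v x = K *v u" using kkt_surj by blast
  have "(\<Sum>j=1..m. K *v (M j *v u)) = K *v u"
    using povm_sum_vec[OF kkt_povm, of u] by (simp flip: matrix_vector_mult_sum_right)
  moreover have "K *v (M j *v u) \<in> supp (A j)" if "j \<in> {1..m}" for j
    using hermitian_mult_in_supp[OF hermitian_A[OF that]] kkt_vec[OF that] by metis
  moreover have "K *v u \<in> supp (A i)"
    using hermitian_mult_in_supp[OF hermitian_A[OF i], of x] u by simp
  ultimately have "K *v (M i *v u) = (if i = i then K *v u else 0)"
    using i by (intro sum_in_supp) auto
  then have "A i *v x = A i *v (M i *v u)"
    by (simp add: u kkt_vec[OF i])
  then show ?thesis by blast
qed

text \<open>The injective K maps the range of M_i onto that of A_i. Hence a basis of supp M_i has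
  the length r_i that \<open>R_choice\<close> demands.\<close>

lemma kkt_rank:
  assumes i: "i \<in> {1..m}"
  shows "rank (A i) = vec.dim (supp (M i))"
proof -
  have "range ((*v) (A i)) = (*v) K ` range ((*v) (M i))"
  proof
    show "range ((*v) (A i)) \<subseteq> (*v) K ` range ((*v) (M i))"
      using kkt_range[OF i] kkt_vec[OF i] by fastforce
    show "(*v) K ` range ((*v) (M i)) \<subseteq> range ((*v) (A i))"
      by (auto simp flip: kkt_vec[OF i])
  qed
  moreover have "vec.dim ((*v) K ` range ((*v) (M i))) = vec.dim (range ((*v) (M i)))"
    using injective_imp_surj(1)[of K] kkt_nonsingular
    by (intro vec.dim_image_eq) (auto intro: inj_on_subset)
  moreover have "supp (M i) = range ((*v) (M i))"
    by (intro supp_projection(1) kkt_povm_hermitian kkt_idem i)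
  ultimately show ?thesis
    by (simp add: rank_hermitian[OF hermitian_A[OF i]])
qed

text \<open>Taking adjoints in A_i M_i = K M_i gives M_i A_i = M_i K; use one equation on each
  side.\<close>

lemma kkt_conjugate:
  assumes i: "i \<in> {1..m}"
  shows "A i ** M i ** A i = K ** M i ** K"
proof -
  have "M i *v (A i *v x) = M i *v (K *v x)" for x
  proof (rule cinner_eqI)
    fix z
    have "cinner z (M i *v (A i *v x)) = cinner (A i *v (M i *v z)) x"
      by (simp add: hermitianD[OF hermitian_A[OF i]] hermitianD[OF kkt_povm_hermitian[OF i]])
    also have "\<dots> = cinner z (M i *v (K *v x))"
      by (simp add: kkt_vec[OF i] hermitianD[OF kkt_hermitian] hermitianD[OF kkt_povm_hermitian[OF i]])
    finally show "cinner z (M i *v (A i *v x)) = cinner z (M i *v (K *v x))" .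
  qed
  then show ?thesis
    by (simp add: matrix_eq matrix_vector_mul_assoc[symmetric] kkt_vec[OF i])
qed

end

end

text \<open>For w an orthonormal eigenbasis of the compression of A to the range of M, with eigenvalues
  l_j, the vectors A w_j / sqrt l_j decompose A and have the diagonal Gram block sqrt l_j.\<close>

lemma decomposition_with_psd_gram:
  fixes A M :: "complex^'n^'n"
  assumes A: "psd A" and M: "hermitian M" "\<And>x. M *v (M *v x) = M *v x"
    and inj: "\<And>x. A *v (M *v x) = 0 \<Longrightarrow> M *v x = 0"
    and range: "\<And>x. \<exists>u. A *v x = A *v (M *v u)"
  shows "\<exists>\<psi> w. A = (\<Sum>j=1..vec.dim (supp M). ketbra (\<psi> j) (\<psi> j)) \<and>
    orthonormal_basis_of (vec.dim (supp M)) w (supp M) \<and>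
    psd_upto (vec.dim (supp M)) (\<lambda>j k. cinner (\<psi> j) (w k))"
proof -
  define d where "d = vec.dim (supp M)"
  note fixed = supp_projection(2)[OF M]
  note hA = hermitianD[OF psd_hermitian[OF A]] and hM = hermitianD[OF M(1)]
  have "hermitian (M ** A ** M)"
    by (simp add: hermitian_def matrix_vector_mul_assoc[symmetric] hA hM)
  moreover have "(M ** A ** M) *v x \<in> supp M" for x
    by (simp add: matrix_vector_mul_assoc[symmetric] hermitian_mult_in_supp[OF M(1)])
  ultimately obtain w l where w: "orthonormal_basis_of d w (supp M)"
    and ev: "\<And>j. j \<in> {1..d} \<Longrightarrow> (M ** A ** M) *v w j = of_real (l j) *s w j"
    using hermitian_eigenbasis[OF _ subspace_supp, of "M ** A ** M" M] unfolding d_def by blast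
  have wS: "w j \<in> supp M" if "j \<in> {1..d}" for j
    using w that by (rule orthonormal_basis_mem)
  have on: "cinner (w j) (w k) = (if j = k then 1 else 0)" if "j \<in> {1..d}" "k \<in> {1..d}" for j k
    using w that by (simp add: orthonormal_basis_of_def)
  have wA: "cinner (w j) (A *v w k) = (if j = k then of_real (l j) else 0)"
    if "j \<in> {1..d}" "k \<in> {1..d}" for j k
  proof -
    have "cinner (w j) (A *v w k) = cinner (M *v w j) (A *v (M *v w k))"
      using that wS by (simp add: fixed)
    also have "\<dots> = cinner (w j) ((M ** A ** M) *v w k)"
      by (simp add: matrix_vector_mul_assoc[symmetric] hM)
    also have "\<dots> = of_real (l k) * (if j = k then 1 else 0)"
      using that by (simp add: ev cinner_scale_right on del: of_real_mult)
    finally show ?thesis by auto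
  qed
  \<comment> \<open>A zero eigenvalue would put w_j into the kernel of A, contrary to
    \<open>inj\<close>; this justifies dividing by sqrt l_j.\<close>
  have pos: "0 < l j" if j: "j \<in> {1..d}" for j
  proof -
    have "0 \<le> l j" using psd_nonneg[OF A, of "w j"] j by (simp add: wA)
    moreover have "l j \<noteq> 0"
    proof
      assume "l j = 0"
      then have "A *v w j = 0" using j by (intro psd_null_vector[OF A]) (simp add: wA)
      then have "w j = 0" using inj[of "w j"] fixed[OF wS[OF j]] by simp
      then show False using on[OF j j] by simp
    qed
    ultimately show ?thesis by simp
  qed
  define \<psi> where "\<psi> j = (1 / sqrt (l j)) *\<^sub>R (A *v w j)" for j
  have "A *v x = (\<Sum>j=1..d. ketbra (\<psi> j) (\<psi> j)) *v x" for x
  proof -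
    obtain u where u: "A *v x = A *v (M *v u)" using range by blast
    \<comment> \<open>Since A x = A M u and A is Hermitian, both sides depend on x only through
      these coordinates of M u.\<close>
    define c where "c j = cinner (w j) (M *v u)" for j
    have y: "M *v u = (\<Sum>j=1..d. c j *s w j)"
      unfolding c_def by (rule orthonormal_expansion[OF w hermitian_mult_in_supp[OF M(1)]])
    have "ketbra (\<psi> j) (\<psi> j) *v x = c j *s (A *v w j)" if j: "j \<in> {1..d}" for j
    proof -
      have "cinner (A *v w j) x = cinner (w j) (A *v (M *v u))"
        by (simp add: hA u)
      also have "\<dots> = (\<Sum>k=1..d. c k * cinner (w j) (A *v w k))"
        by (simp add: y matrix_vector_mult_sum_right cinner_sum_right matrix_vector_mult_scale
            cinner_scale_right)
      also have "\<dots> = (\<Sum>k=1..d. if k = j then c j * of_real (l j) else 0)"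
        using j by (intro sum.cong refl) (auto simp: wA)
      also have "\<dots> = c j * of_real (l j)" using j by simp
      finally have *: "cinner (A *v w j) x = c j * of_real (l j)" .
      have "sqrt (l j) * sqrt (l j) = l j" using pos[OF j] by simp
      then have "complex_of_real (sqrt (l j)) * of_real (sqrt (l j)) = of_real (l j)"
        by (metis of_real_mult)
      then show ?thesis
        using pos[OF j]
        by (simp add: \<psi>_def ketbra_mult_vec cinner_scaleR_left cinner_scale_left scaleR_conv_scale *
              field_simps)
    qed
    then show ?thesis
      by (simp add: matrix_vector_mult_sum_left u y matrix_vector_mult_sum_right
          matrix_vector_mult_scale)
  qed
  then have "A = (\<Sum>j=1..d. ketbra (\<psi> j) (\<psi> j))" by (simp add: matrix_eq)
  moreover have "psd_upto d (\<lambda>j k. cinner (\<psi> j) (w k))"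
    unfolding psd_upto_def
  proof
    fix x :: "nat \<Rightarrow> complex"
    have gram: "cinner (\<psi> j) (w k) = (if k = j then of_real (sqrt (l j)) else 0)"
      if j: "j \<in> {1..d}" and k: "k \<in> {1..d}" for j k
    proof -
      have "complex_of_real (l j / sqrt (l j)) = of_real (sqrt (l j))"
        using pos[OF j] by (simp add: real_div_sqrt)
      then show ?thesis
        using wA[OF j k] by (auto simp: \<psi>_def cinner_scaleR_left hA)
    qed
    have "(\<Sum>j=1..d. \<Sum>k=1..d. cnj (x j) * cinner (\<psi> j) (w k) * x k)
        = (\<Sum>j=1..d. \<Sum>k=1..d. if k = j then of_real (sqrt (l j) * (cmod (x j))\<^sup>2) else 0)"
      by (intro sum.cong refl)
        (auto simp: gram complex_norm_square mult_ac simp del: of_real_power)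
    also have "\<dots> = of_real (\<Sum>j=1..d. sqrt (l j) * (cmod (x j))\<^sup>2)" by simp
    finally show "(\<Sum>j=1..d. \<Sum>k=1..d. cnj (x j) * cinner (\<psi> j) (w k) * x k) \<in> \<real>\<^sub>\<ge>\<^sub>0"
      by (auto simp del: of_real_sum of_real_mult intro!: sum_nonneg mult_nonneg_nonneg
          less_imp_le[OF pos])
  qed
  ultimately show ?thesis using w unfolding d_def by blast
qed

section \<open>The map R\<close>

lemma ensemblesD:
  assumes "P \<in> ensembles m r" "i \<in> {1..m}"
  shows "0 < fst (P i)" "psd (snd (P i))" "trace (snd (P i)) = 1" "rank (snd (P i)) = r i"
  using assms unfolding ensembles_def density_operator_def by blast+

lemma independent_states_weighted:
  assumes "P \<in> ensembles m r"
  shows "independent_states m (weighted_state P)"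
proof -
  note pos = ensemblesD(1)[OF assms]
  have "supp (weighted_state P i) = supp (snd (P i))" if "i \<in> {1..m}" for i
    using pos[OF that] by (simp add: supp_def weighted_state_def matrix_vector_mult_scaleR_left)
  then have "independent_subspaces {1..m} (\<lambda>i. supp (weighted_state P i))"
    and "(\<Union>i\<in>{1..m}. supp (weighted_state P i)) = (\<Union>i\<in>{1..m}. supp (snd (P i)))"
    using assms by (auto simp: ensembles_def independent_subspaces_def)
  moreover have "psd (weighted_state P i)" if "i \<in> {1..m}" for i
    using ensemblesD[OF assms that] by (simp add: weighted_state_def psd_scaleR)
  ultimately show ?thesis
    using assms by unfold_locales (simp_all add: ensembles_def)
qed

lemma rank_weighted_state:
  assumes P: "P \<in> ensembles m r" and i: "i \<in> {1..m}"
  shows "rank (weighted_state P i) = r i"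
proof -
  interpret independent_states m "weighted_state P"
    by (rule independent_states_weighted[OF P])
  have p: "fst (P i) > 0" "hermitian (snd (P i))" "rank (snd (P i)) = r i"
    using ensemblesD[OF P i] by (simp_all add: psd_hermitian)
  have "range ((*v) (weighted_state P i)) = range ((*v) (snd (P i)))"
  proof (intro equalityI subsetI)
    fix y assume "y \<in> range ((*v) (weighted_state P i))"
    then obtain x where "y = snd (P i) *v (fst (P i) *\<^sub>R x)"
      by (auto simp: weighted_state_def matrix_vector_mult_scaleR_left matrix_vector_mult_scaleR_right)
    then show "y \<in> range ((*v) (snd (P i)))" by blast
  next
    fix y assume "y \<in> range ((*v) (snd (P i)))"
    then obtain x where "y = snd (P i) *v x" by blast
    then have "y = weighted_state P i *v ((1 / fst (P i)) *\<^sub>R x)"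
      using p(1) by (simp add: weighted_state_def matrix_vector_mult_scaleR_left
          matrix_vector_mult_scaleR_right)
    then show "y \<in> range ((*v) (weighted_state P i))" by blast
  qed
  then show ?thesis
    using p by (simp add: rank_hermitian hermitian_A[OF i])
qed

lemma ensembles_nonempty_index: "P \<in> ensembles m r \<Longrightarrow> 1 \<le> m"
  by (cases m) (auto simp: ensembles_def)

text \<open>Unchanged when all S_i are multiplied by the same positive factor; this is the only
  information lost.\<close>

definition normalized_ensemble :: "nat \<Rightarrow> (nat \<Rightarrow> complex^'n^'n) \<Rightarrow> 'n::finite ensemble" where
  "normalized_ensemble m S = (\<lambda>i\<in>{1..m}.
     (Re (trace (S i)) / (\<Sum>l=1..m. Re (trace (S l))), (1 / Re (trace (S i))) *\<^sub>R S i))"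

text \<open>The matrix sum_j |psi_j><psi_j| is p_i rho_i, so chi_j = p_i rho_i w_j: the decomposition and
  the phase convention for w drop out.\<close>

lemma chi_vec_eq:
  assumes "R_choice m r P M \<psi> w" "i \<in> {1..m}"
  shows "chi_vec r \<psi> w i j = weighted_state P i *v w i j"
proof -
  have "weighted_state P i = (\<Sum>j=1..r i. ketbra (\<psi> i j) (\<psi> i j))"
    using assms by (simp add: R_choice_def weighted_state_def)
  then show ?thesis
    by (simp add: chi_vec_def gram_block_def matrix_vector_mult_sum_left ketbra_mult_vec)
qed

lemma ensemble_of_vectors_eq:
  "ensemble_of_vectors m r v = normalized_ensemble m (\<lambda>i. \<Sum>j=1..r i. ketbra (v i j) (v i j))"
  by (simp add: ensemble_of_vectors_def normalized_ensemble_def trace_sum trace_ketbra)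

lemma normalized_ensemble_cong:
  "(\<And>i. i \<in> {1..m} \<Longrightarrow> S i = T i) \<Longrightarrow> normalized_ensemble m S = normalized_ensemble m T"
  unfolding normalized_ensemble_def by (intro restrict_ext) simp

lemma sum_ketbra_conjugate:
  assumes "hermitian A"
  shows "(\<Sum>j\<in>J. ketbra (A *v w j) (A *v w j)) = A ** (\<Sum>j\<in>J. ketbra (w j) (w j)) ** A"
  by (simp add: matrix_eq matrix_vector_mul_assoc[symmetric] matrix_vector_mult_sum_left
      matrix_vector_mult_sum_right ketbra_mult_vec matrix_vector_mult_scale hermitianD[OF assms])

context independent_states
begin

lemma R_choice_value:
  assumes A: "A = weighted_state P" and kkt: "kkt_point m A K M" and choice: "R_choice m r P M \<psi> w"
  shows "ensemble_of_vectors m r (chi_vec r \<psi> w) = normalized_ensemble m (\<lambda>i. K ** M i ** K)"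
  unfolding ensemble_of_vectors_eq
proof (rule normalized_ensemble_cong)
  fix i assume i: "i \<in> {1..m}"
  have "orthonormal_basis_of (r i) (w i) (supp (M i))"
    using choice i by (simp add: R_choice_def)
  then have "(\<Sum>j=1..r i. ketbra (w i j) (w i j)) = M i"
    by (intro sum_ketbra_orthonormal_basis kkt_povm_hermitian[OF kkt i] kkt_idem[OF kkt i])
  then show "(\<Sum>j=1..r i. ketbra (chi_vec r \<psi> w i j) (chi_vec r \<psi> w i j)) = K ** M i ** K"
    by (simp add: chi_vec_eq[OF choice i] A[symmetric] sum_ketbra_conjugate hermitian_A[OF i]
        kkt_conjugate[OF kkt i])
qed

lemma R_choice_exists:
  assumes A: "A = weighted_state P" and kkt: "kkt_point m A K M" and opt: "optimal_povm m P M"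
    and rank: "\<And>i. i \<in> {1..m} \<Longrightarrow> rank (A i) = r i"
  shows "\<exists>\<psi> w. R_choice m r P M \<psi> w"
proof -
  have "\<exists>\<psi> w. A i = (\<Sum>j=1..r i. ketbra (\<psi> j) (\<psi> j)) \<and>
    orthonormal_basis_of (r i) w (supp (M i)) \<and> psd_upto (r i) (\<lambda>j k. cinner (\<psi> j) (w k))"
    if i: "i \<in> {1..m}" for i
  proof -
    have "vec.dim (supp (M i)) = r i"
      using kkt_rank[OF kkt i] rank[OF i] by simp
    moreover have "M i *v x = 0" if "A i *v (M i *v x) = 0" for x
      using that kkt_nonsingular[OF kkt, of "M i *v x"] by (simp add: kkt_vec[OF kkt i])
    ultimately show ?thesis
      using decomposition_with_psd_gram[OF psd_A[OF i] kkt_povm_hermitian[OF kkt i]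
          kkt_idem[OF kkt i] _ kkt_range[OF kkt i]] by simp
  qed
  then have "\<forall>i\<in>{1..m}. \<exists>\<psi> w. A i = (\<Sum>j=1..r i. ketbra (\<psi> j) (\<psi> j)) \<and>
    orthonormal_basis_of (r i) w (supp (M i)) \<and> psd_upto (r i) (\<lambda>j k. cinner (\<psi> j) (w k))"
    by blast
  from bchoice[OF this] obtain \<psi> where "\<forall>i\<in>{1..m}. \<exists>w.
    A i = (\<Sum>j=1..r i. ketbra (\<psi> i j) (\<psi> i j)) \<and> orthonormal_basis_of (r i) w (supp (M i)) \<and>
    psd_upto (r i) (\<lambda>j k. cinner (\<psi> i j) (w k))" ..
  from bchoice[OF this] obtain w where "\<forall>i\<in>{1..m}.
    A i = (\<Sum>j=1..r i. ketbra (\<psi> i j) (\<psi> i j)) \<and> orthonormal_basis_of (r i) (w i) (supp (M i)) \<and>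
    psd_upto (r i) (\<lambda>j k. cinner (\<psi> i j) (w i k))" ..
  then have "R_choice m r P M \<psi> w"
    using opt unfolding R_choice_def A gram_block_def[abs_def] weighted_state_def by simp
  then show ?thesis by blast
qed

end

text \<open>Resolves the description: \<open>R_choice_exists\<close> gives a value, and by
  \<open>kkt_unique\<close> with the common K any other choice gives the same one.\<close>

lemma R_map_eq:
  fixes P :: "'n::finite ensemble"
  assumes P: "P \<in> ensembles m r"
  obtains K M where "kkt_point m (weighted_state P) K M"
    "R_map m r P = normalized_ensemble m (\<lambda>i. K ** M i ** K)"
proof -
  interpret independent_states m "weighted_state P"
    by (rule independent_states_weighted[OF P])
  obtain K where K: "\<And>M. optimal_povm m P M \<Longrightarrow> kkt_point m (weighted_state P) K M"
    using optimal_kkt_point[OF psd_A] by blast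
  obtain M where M: "optimal_povm m P M"
    using optimal_povm_exists[OF ensembles_nonempty_index[OF P]] by blast
  note kkt = K[OF M]
  obtain \<psi> w where choice: "R_choice m r P M \<psi> w"
    using R_choice_exists[OF refl kkt M rank_weighted_state[OF P]] by blast
  have "R_map m r P = normalized_ensemble m (\<lambda>i. K ** M i ** K)"
    unfolding R_map_def
  proof (rule the_equality)
    show "\<exists>M' \<psi> w. R_choice m r P M' \<psi> w \<and>
        normalized_ensemble m (\<lambda>i. K ** M i ** K) = ensemble_of_vectors m r (chi_vec r \<psi> w)"
      using choice R_choice_value[OF refl kkt choice] by metis
    fix Q assume "\<exists>N \<psi> w. R_choice m r P N \<psi> w \<and> Q = ensemble_of_vectors m r (chi_vec r \<psi> w)"
    then obtain N \<psi>' w' where N: "R_choice m r P N \<psi>' w'"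
      and Q: "Q = ensemble_of_vectors m r (chi_vec r \<psi>' w')" by blast
    have kktN: "kkt_point m (weighted_state P) K N"
      using N by (intro K) (simp add: R_choice_def)
    have "Q = normalized_ensemble m (\<lambda>i. K ** N i ** K)"
      unfolding Q by (rule R_choice_value[OF refl kktN N])
    also have "\<dots> = normalized_ensemble m (\<lambda>i. K ** M i ** K)"
      by (intro normalized_ensemble_cong) (simp only: kkt_unique[OF kkt kktN])
    finally show "Q = normalized_ensemble m (\<lambda>i. K ** M i ** K)" .
  qed
  with kkt show ?thesis by (rule that)
qed

section \<open>Injectivity\<close>

text \<open>With D = K - L, D K = - L D, so tr (K D^2) = tr (D K D) = - tr (L D^2); both traces are
  nonnegative.\<close>

lemma psd_sqrt_unique:
  fixes K L :: "complex^'n^'n"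
  assumes K: "psd K" and L: "psd L" and eq: "K ** K = L ** L"
    and inj: "\<And>x. K *v x = 0 \<Longrightarrow> x = 0"
  shows "K = L"
proof -
  define D where "D = K - L"
  have hD: "hermitian D"
    unfolding D_def by (intro hermitian_diff psd_hermitian K L)
  have sq: "K *v (K *v x) = L *v (L *v x)" for x
    using eq by (metis matrix_vector_mul_assoc)
  have comm: "K *v (L *v (L *v x)) = L *v (L *v (K *v x))" for x
    by (metis sq)
  \<comment> \<open>D K = K^2 - L K = L^2 - L K = - L D, multiplied by D on the right.\<close>
  have "D ** K ** D + L ** D ** D = 0"
    by (simp add: matrix_eq matrix_vector_mul_assoc[symmetric] matrix_vector_mult_add_rdistrib D_def
        matrix_vector_mult_diff_rdistrib matrix_vector_mult_diff_distrib sq comm)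
  then have "trace (D ** K ** D) + trace (L ** D ** D) = 0"
    unfolding trace_add[symmetric] by (simp add: trace_def)
  then have "trace (D ** K ** D) = - trace (L ** (D ** D))"
    by (simp add: matrix_mul_assoc eq_neg_iff_add_eq_0)
  moreover have "trace (D ** K ** D) = trace (K ** (D ** D))"
    by (metis matrix_mul_assoc trace_mul_sym)
  ultimately have "Re (trace (K ** (D ** D))) = - Re (trace (L ** (D ** D)))" by simp
  moreover have psd_DD: "psd (D ** D)"
  proof -
    have "cinner x ((D ** D) *v x) = cinner (D *v x) (D *v x)" for x
      using hermitianD[OF hD] by (simp add: matrix_vector_mul_assoc[symmetric])
    then show ?thesis
      by (simp add: psd_def cinner_self del: of_real_power)
  qed
  ultimately have "Re (trace (K ** (D ** D))) = 0"
    using psd_trace_mult_nonneg[OF K psd_DD] psd_trace_mult_nonneg[OF L psd_DD] by linarith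
  then have "K ** (D ** D) = 0"
    by (rule psd_trace_mult_eq_0[OF K psd_DD])
  then have "K *v (D *v (D *v x)) = 0" for x
    by (simp add: matrix_vector_mul_assoc matrix_mul_assoc)
  then have "D *v (D *v x) = 0" for x
    using inj by blast
  then have "cinner (D *v x) (D *v x) = 0" for x
    by (simp add: hermitianD[OF hD])
  then have "D = 0" by (simp add: matrix_eq)
  then show ?thesis by (simp add: D_def)
qed

text \<open>With A x = A M u, the vector z = x - M u is in the kernel of A. Writing B B z = B M v,
  the squared norm of B z is <z, B M v> = <z, A M v> = <A z, M v> = 0, so B x = B M u = A M
  u.\<close>

lemma hermitian_eqI:
  fixes A B M :: "complex^'n^'n"
  assumes A: "hermitian A" "\<And>x. \<exists>u. A *v x = A *v (M *v u)"
    and B: "hermitian B" "\<And>x. \<exists>u. B *v x = B *v (M *v u)"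
    and eq: "\<And>x. A *v (M *v x) = B *v (M *v x)"
  shows "A = B"
proof -
  have "A *v x = B *v x" for x
  proof -
    obtain u where u: "A *v x = A *v (M *v u)" using A by blast
    define z where "z = x - M *v u"
    obtain v where v: "B *v (B *v z) = B *v (M *v v)" using B by blast
    have "cinner (B *v z) (B *v z) = cinner z (B *v (B *v z))"
      by (simp add: hermitianD[OF B(1)])
    also have "\<dots> = cinner (A *v z) (M *v v)"
      by (simp add: v hermitianD[OF A(1)] flip: eq)
    also have "A *v z = 0"
      by (simp add: z_def matrix_vector_mult_diff_distrib u)
    finally have "B *v z = 0" by simp
    then show ?thesis
      by (simp add: u eq z_def matrix_vector_mult_diff_distrib)
  qed
  then show ?thesis by (simp add: matrix_eq)
qed

lemma normalized_ensemble_weighted: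
  assumes i: "i \<in> {1..m}" and S: "psd (S i)"
  shows "weighted_state (normalized_ensemble m S) i = (1 / (\<Sum>l=1..m. Re (trace (S l)))) *\<^sub>R S i"
proof (cases "Re (trace (S i)) = 0")
  case True
  moreover have "psd (mat 1 :: complex^'a^'a)"
    by (simp add: psd_def cinner_self del: of_real_power)
  ultimately have "S i ** mat 1 = 0"
    by (intro psd_trace_mult_eq_0 S) simp_all
  then show ?thesis
    using i by (simp add: weighted_state_def normalized_ensemble_def)
next
  case False
  then show ?thesis
    using i by (simp add: weighted_state_def normalized_ensemble_def)
qed

text \<open>For Hermitian K the trace of K^2 is the sum of the squared norms of the columns of
  K.\<close>

lemma hermitian_trace_square:
  assumes "hermitian K"
  shows "0 \<le> Re (trace (K ** K))" and "Re (trace (K ** K)) = 0 \<Longrightarrow> K = 0"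
proof -
  have tr: "Re (trace (K ** K)) = (\<Sum>k\<in>UNIV. (norm (K *v axis k 1))\<^sup>2)"
    by (simp add: trace_eq_sum_cinner matrix_vector_mul_assoc[symmetric] cinner_self
        flip: hermitianD[OF assms])
  then show "0 \<le> Re (trace (K ** K))" by (simp add: sum_nonneg)
  assume "Re (trace (K ** K)) = 0"
  then have "K *v axis k 1 = 0" for k
    using tr by (simp add: sum_nonneg_eq_0_iff)
  then have "K $ i $ j = 0" for i j
    using cinner_axis_mult_axis[of i K j] by simp
  then show "K = 0" by (simp add: vec_eq_iff)
qed

context independent_states
begin

lemma kkt_sum:
  assumes "kkt_point m A K M"
  shows "(\<Sum>i=1..m. K ** M i ** K) = K ** K"
proof -
  have "(\<Sum>i=1..m. M i) = mat 1"
    using kkt_povm[OF assms] by (simp add: povm_def)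
  then show ?thesis
    by (simp flip: matrix_mult_sum_left matrix_mult_sum_right)
qed

lemma kkt_conjugate_psd:
  assumes "kkt_point m A K M" "i \<in> {1..m}"
  shows "psd (K ** M i ** K)"
  using kkt_povm[OF assms(1)] assms(2)
  by (intro psd_sandwich kkt_hermitian[OF assms(1)]) (simp add: povm_def)

lemma kkt_trace_pos:
  assumes kkt: "kkt_point m A K M"
  shows "0 < (\<Sum>i=1..m. Re (trace (K ** M i ** K)))"
proof -
  have "K \<noteq> 0"
    using kkt_nonsingular[OF kkt, of "axis undefined 1"] by auto
  then have "0 < Re (trace (K ** K))"
    using hermitian_trace_square[OF kkt_hermitian[OF kkt]] by (metis order_le_less)
  also have "K ** K = (\<Sum>i=1..m. K ** M i ** K)"
    by (rule kkt_sum[OF kkt, symmetric])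
  finally show ?thesis by (simp add: trace_sum)
qed

end

text \<open>Summing \<open>eq\<close> over i gives K^2 = (c L)^2, so K = c L by uniqueness of the
  positive root. Cancelling the invertible K identifies the measurements, and
  \<open>hermitian_eqI\<close> finishes.\<close>

lemma kkt_determines_states:
  fixes A B :: "nat \<Rightarrow> complex^'n^'n"
  assumes "independent_states m A" "independent_states m B"
    and K: "kkt_point m A K M" and L: "kkt_point m B L N" and c: "0 < c" and m: "1 \<le> m"
    and eq: "\<And>i. i \<in> {1..m} \<Longrightarrow> K ** M i ** K = c\<^sup>2 *\<^sub>R (L ** N i ** L)"
    and i: "i \<in> {1..m}"
  shows "A i = c *\<^sub>R B i"
proof -
  interpret A: independent_states m A by fact
  interpret B: independent_states m B by fact
  have "K ** K = (\<Sum>i=1..m. c\<^sup>2 *\<^sub>R (L ** N i ** L))"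
    unfolding A.kkt_sum[OF K, symmetric] by (intro sum.cong refl eq)
  also have "\<dots> = c\<^sup>2 *\<^sub>R (L ** L)"
    using B.kkt_sum[OF L] by (simp flip: scaleR_sum_right)
  finally have "K ** K = (c *\<^sub>R L) ** (c *\<^sub>R L)"
    by (simp add: matrix_eq matrix_vector_mul_assoc[symmetric] matrix_vector_mult_scaleR_left
        matrix_vector_mult_scaleR_right power2_eq_square)
  then have KL: "K = c *\<^sub>R L"
    using c by (intro psd_sqrt_unique[OF A.kkt_psd[OF K m] psd_scaleR[OF B.kkt_psd[OF L m]]])
      (simp_all add: A.kkt_nonsingular[OF K])
  have "M i *v y = N i *v y" for y
  proof -
    obtain x where x: "y = K *v x" using A.kkt_surj[OF K] by blast
    have "K *v (M i *v (K *v x)) = K *v (N i *v (K *v x))"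
      using arg_cong[OF eq[OF i], of "\<lambda>X. X *v x"]
      by (simp add: matrix_vector_mul_assoc[symmetric] KL matrix_vector_mult_scaleR_left
          matrix_vector_mult_scaleR_right power2_eq_square)
    then show ?thesis by (simp add: A.kkt_inj[OF K] x)
  qed
  then have MN: "M i = N i" by (simp add: matrix_eq)
  show ?thesis
  proof (rule hermitian_eqI[where M = "M i"])
    show "hermitian (A i)" by (rule A.hermitian_A[OF i])
    show "hermitian (c *\<^sub>R B i)"
      using B.hermitian_A[OF i] by (simp add: hermitian_def matrix_vector_mult_scaleR_left
          cinner_scaleR_left cinner_scaleR_right)
    show "\<exists>u. A i *v x = A i *v (M i *v u)" for x
      by (rule A.kkt_range[OF K i])
    show "\<exists>u. (c *\<^sub>R B i) *v x = (c *\<^sub>R B i) *v (M i *v u)" for x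
      using B.kkt_range[OF L i, of x] by (auto simp: MN matrix_vector_mult_scaleR_left)
    show "A i *v (M i *v x) = (c *\<^sub>R B i) *v (M i *v x)" for x
      using A.kkt_vec[OF K i, of x] B.kkt_vec[OF L i, of x]
      by (simp add: KL matrix_vector_mult_scaleR_left MN)
  qed
qed

theorem theorem3p2p2:
  fixes m :: nat and r :: "nat \<Rightarrow> nat"
  assumes "\<And>i j. 1 \<le> i \<Longrightarrow> i \<le> j \<Longrightarrow> j \<le> m \<Longrightarrow> r j \<le> r i"
    and "\<And>i. i \<in> {1..m} \<Longrightarrow> 1 \<le> r i"
    and "(\<Sum>i=1..m. r i) = CARD('n::finite)"
  shows "inj_on (R_map m r) (ensembles m r :: 'n ensemble set)"
proof (rule inj_onI)
  fix P Q :: "'n ensemble"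
  assume P: "P \<in> ensembles m r" and Q: "Q \<in> ensembles m r" and eq: "R_map m r P = R_map m r Q"
  interpret P: independent_states m "weighted_state P" by (rule independent_states_weighted[OF P])
  interpret Q: independent_states m "weighted_state Q" by (rule independent_states_weighted[OF Q])
  have m: "1 \<le> m" by (rule ensembles_nonempty_index[OF P])
  obtain K M where K: "kkt_point m (weighted_state P) K M"
    and RP: "R_map m r P = normalized_ensemble m (\<lambda>i. K ** M i ** K)"
    by (rule R_map_eq[OF P])
  obtain L N where L: "kkt_point m (weighted_state Q) L N"
    and RQ: "R_map m r Q = normalized_ensemble m (\<lambda>i. L ** N i ** L)"
    by (rule R_map_eq[OF Q])
  define s where "s = (\<Sum>i=1..m. Re (trace (K ** M i ** K)))"
  define t where "t = (\<Sum>i=1..m. Re (trace (L ** N i ** L)))"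
  have s: "0 < s" unfolding s_def by (rule P.kkt_trace_pos[OF K])
  have t: "0 < t" unfolding t_def by (rule Q.kkt_trace_pos[OF L])
  \<comment> \<open>Equal images mean (1/s) K M_i K = (1/t) L N_i L, so s/t is the factor written as
    c^2 in \<open>kkt_determines_states\<close>.\<close>
  define c where "c = sqrt (s / t)"
  have c: "0 < c" "c\<^sup>2 = s / t" using s t by (simp_all add: c_def)
  have "K ** M i ** K = c\<^sup>2 *\<^sub>R (L ** N i ** L)" if i: "i \<in> {1..m}" for i
  proof -
    have "(1 / s) *\<^sub>R (K ** M i ** K) = (1 / t) *\<^sub>R (L ** N i ** L)"
      using normalized_ensemble_weighted[OF i, of "\<lambda>i. K ** M i ** K", OF P.kkt_conjugate_psd[OF K i]]
        normalized_ensemble_weighted[OF i, of "\<lambda>i. L ** N i ** L", OF Q.kkt_conjugate_psd[OF L i]] eq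
      by (simp add: RP RQ s_def t_def)
    then have "s *\<^sub>R (1 / s) *\<^sub>R (K ** M i ** K) = s *\<^sub>R (1 / t) *\<^sub>R (L ** N i ** L)"
      by (rule arg_cong)
    then show ?thesis using s by (simp add: c(2))
  qed
  then have state: "fst (P i) *\<^sub>R snd (P i) = (c * fst (Q i)) *\<^sub>R snd (Q i)" if "i \<in> {1..m}" for i
    using kkt_determines_states[OF P.independent_states_axioms Q.independent_states_axioms K L c(1) m]
      that by (simp add: weighted_state_def)
  have prob: "fst (P i) = c * fst (Q i)" if i: "i \<in> {1..m}" for i
  proof -
    have "complex_of_real (fst (P i)) = of_real (c * fst (Q i))"
      using arg_cong[OF state[OF i], of trace]
      by (simp add: trace_scaleR ensemblesD(3)[OF P i] ensemblesD(3)[OF Q i])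
    then show ?thesis by (simp only: of_real_eq_iff)
  qed
  have "(\<Sum>i=1..m. fst (P i)) = (\<Sum>i=1..m. c * fst (Q i))"
    by (intro sum.cong refl prob)
  \<comment> \<open>Both families of probabilities sum to 1.\<close>
  then have "c = 1"
    using P Q by (simp add: ensembles_def flip: sum_distrib_left)
  show "P = Q"
  proof (rule extensionalityI)
    show "P \<in> extensional {1..m}" "Q \<in> extensional {1..m}"
      using P Q by (auto simp: ensembles_def)
    fix i assume i: "i \<in> {1..m}"
    have "fst (P i) \<noteq> 0" using ensemblesD(1)[OF P i] by simp
    with state[OF i] prob[OF i] \<open>c = 1\<close> show "P i = Q i"
      by (simp add: prod_eq_iff)
  qed
qed

end
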